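(* Let $A$ be a commutative noetherian local ring, and let $x,y \in A$ be a regular exact pair of zero divisors. Let $(b_n)_{n \geqslant 1}$ be a sequence of (not necessarily distinct) elements of $A$ each of which is regular on the $A$-module $A/(x,y)$, and set $a_n = b_1 \cdots b_n$ for $n \geqslant 1$. Then \[ G_{a_1}, G_{a_2}, G_{a_3}, \ldots, H_{a_1}, H_{a_2}, H_{a_3}, \ldots \] is a family of indecomposable, non-free, totally reflexive $A$-modules which are pairwise non-isomorphic. Furthermore, for all $m,n \geqslant 1$ there are $A$-module isomorphisms \[ \operatorname{Hom}_A(H_{a_m},G_{a_n}) \cong \operatorname{Hom}_A(H_{a_n},G_{a_m}) \cong G_{a_m a_n}, \qquad \operatorname{Hom}_A(G_{a_n},H_{a_m}) \cong \operatorname{Hom}_A(G_{a_m},H_{a_n}) \cong H_{a_m a_n}, \] and \[ \operatorname{Hom}_A(G_{a_m},G_{a_n}) \cong \operatorname{Hom}_A(H_{a_n},H_{a_m}) \cong \begin{cases} H_{a_m/a_n} & \text{if } m \geqslant n,\\ G_{a_n/a_m} & \text{if } m \leqslant n,\end{cases} \] where for $m \geqslant n$, $a_m/a_n$ denotes the product $b_{n+1}\cdots b_m$ (equal to $1$ when $m=n$), and similarly for $a_n/a_m$ when $n \geqslant m$.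
   Context: Two non-units $x,y\in A$ form an exact pair of zero divisors if $\operatorname{Ann}_A(x)=(y)$ and $\operatorname{Ann}_A(y)=(x)$; such a pair is called regular if $(x)\cap(y)=0$ (equivalently, $x$ is regular on $A/(y)$, equivalently $y$ is regular on $A/(x)$). An element $a\in A$ is weakly regular on a finitely generated $A$-module $M$ if multiplication by $a$ on $M$ is injective; it is regular on $M$ if in addition $a$ is a non-unit. For $a\in A$ define the $2\times 2$ matrices $\gamma_a=\begin{pmatrix} x & a\\ 0 & y\end{pmatrix}$ and $\eta_a=\begin{pmatrix} y & -a\\ 0 & x\end{pmatrix}$, viewed as $A$-linear maps $A^2\to A^2$ acting on column vectors by left multiplication, and set $G_a=\operatorname{Coker}\gamma_a$ and $H_a=\operatorname{Coker}\eta_a$. A finitely generated $A$-module $G$ is totally reflexive if $\operatorname{Ext}^i_A(G,A)=0$ and $\operatorname{Ext}^i_A(\operatorname{Hom}_A(G,A),A)=0$ for all $i>0$, and the biduality map $G\to\operatorname{Hom}_A(\operatorname{Hom}_A(G,A),A)$ is an isomorphism. *)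

theory Defs
  imports Main
begin

definition ring_ideal :: "'a::comm_ring_1 set \<Rightarrow> bool" where
  "ring_ideal I \<longleftrightarrow> 0 \<in> I \<and> (\<forall>u\<in>I. \<forall>v\<in>I. u + v \<in> I) \<and> (\<forall>r. \<forall>u\<in>I. r * u \<in> I)"

definition gen_ideal :: "'a::comm_ring_1 set \<Rightarrow> 'a set" where
  "gen_ideal S = \<Inter>{J. ring_ideal J \<and> S \<subseteq> J}"

definition noetherian_ring :: "'a::comm_ring_1 itself \<Rightarrow> bool" where
  "noetherian_ring _ \<longleftrightarrow>
     (\<forall>I::'a set. ring_ideal I \<longrightarrow> (\<exists>S. finite S \<and> S \<subseteq> I \<and> I = gen_ideal S))"

definition maximal_ideal :: "'a::comm_ring_1 set \<Rightarrow> bool" where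
  "maximal_ideal m \<longleftrightarrow> ring_ideal m \<and> m \<noteq> UNIV \<and>
     (\<forall>J. ring_ideal J \<and> m \<subseteq> J \<longrightarrow> J = m \<or> J = UNIV)"

definition local_ring :: "'a::comm_ring_1 itself \<Rightarrow> bool" where
  "local_ring _ \<longleftrightarrow> (\<exists>!m::'a set. maximal_ideal m)"

definition pideal :: "'a::comm_ring_1 \<Rightarrow> 'a set" where
  "pideal x = {x * r | r. True}"

definition ann :: "'a::comm_ring_1 \<Rightarrow> 'a set" where
  "ann x = {r. r * x = 0}"

definition exact_pair :: "'a::comm_ring_1 \<Rightarrow> 'a \<Rightarrow> bool" where
  "exact_pair x y \<longleftrightarrow> \<not> x dvd 1 \<and> \<not> y dvd 1 \<and> ann x = pideal y \<and> ann y = pideal x"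

definition regular_exact_pair :: "'a::comm_ring_1 \<Rightarrow> 'a \<Rightarrow> bool" where
  "regular_exact_pair x y \<longleftrightarrow> exact_pair x y \<and> pideal x \<inter> pideal y = {0}"

record ('a, 'm) amod =
  mcarrier :: "'m set"
  madd :: "'m \<Rightarrow> 'm \<Rightarrow> 'm"
  mzero :: 'm
  msmul :: "'a \<Rightarrow> 'm \<Rightarrow> 'm"

definition mlinear :: "('m \<Rightarrow> 'n) \<Rightarrow> ('a::comm_ring_1, 'm) amod \<Rightarrow> ('a, 'n) amod \<Rightarrow> bool" where
  "mlinear f M N \<longleftrightarrow> (\<forall>u\<in>mcarrier M. f u \<in> mcarrier N)
     \<and> (\<forall>u\<in>mcarrier M. \<forall>v\<in>mcarrier M. f (madd M u v) = madd N (f u) (f v))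
     \<and> (\<forall>r. \<forall>u\<in>mcarrier M. f (msmul M r u) = msmul N r (f u))"

definition miso :: "('a::comm_ring_1, 'm) amod \<Rightarrow> ('a, 'n) amod \<Rightarrow> bool" where
  "miso M N \<longleftrightarrow> (\<exists>f. mlinear f M N \<and> bij_betw f (mcarrier M) (mcarrier N))"

text \<open>Hom_A(M,N); homomorphisms are made extensional (zero outside the carrier).\<close>
definition hom_mod :: "('a::comm_ring_1, 'm) amod \<Rightarrow> ('a, 'n) amod \<Rightarrow> ('a, 'm \<Rightarrow> 'n) amod" where
  "hom_mod M N = \<lparr> mcarrier = {f. mlinear f M N \<and> (\<forall>u. u \<notin> mcarrier M \<longrightarrow> f u = mzero N)},
     madd = (\<lambda>f g u. if u \<in> mcarrier M then madd N (f u) (g u) else mzero N),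
     mzero = (\<lambda>u. mzero N),
     msmul = (\<lambda>r f u. if u \<in> mcarrier M then msmul N r (f u) else mzero N) \<rparr>"

definition ring_mod :: "('a::comm_ring_1, 'a) amod" where
  "ring_mod = \<lparr> mcarrier = UNIV, madd = (+), mzero = 0, msmul = (*) \<rparr>"

definition fmod :: "nat \<Rightarrow> ('a::comm_ring_1, nat \<Rightarrow> 'a) amod" where
  "fmod n = \<lparr> mcarrier = {v. \<forall>i\<ge>n. v i = 0}, madd = (\<lambda>u v i. u i + v i),
     mzero = (\<lambda>i. 0), msmul = (\<lambda>r v i. r * v i) \<rparr>"

definition matmap :: "nat \<Rightarrow> nat \<Rightarrow> (nat \<Rightarrow> nat \<Rightarrow> 'a::comm_ring_1) \<Rightarrow> (nat \<Rightarrow> 'a) \<Rightarrow> (nat \<Rightarrow> 'a)" where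
  "matmap m k D v = (\<lambda>i. if i < m then (\<Sum>j<k. D i j * v j) else 0)"

definition submodule :: "'m set \<Rightarrow> ('a::comm_ring_1, 'm) amod \<Rightarrow> bool" where
  "submodule S M \<longleftrightarrow> S \<subseteq> mcarrier M \<and> mzero M \<in> S
     \<and> (\<forall>u\<in>S. \<forall>v\<in>S. madd M u v \<in> S) \<and> (\<forall>r. \<forall>u\<in>S. msmul M r u \<in> S)"

definition mcoset :: "('a, 'm) amod \<Rightarrow> 'm set \<Rightarrow> 'm \<Rightarrow> 'm set" where
  "mcoset M S u = {madd M u s | s. s \<in> S}"

definition qmod :: "('a::comm_ring_1, 'm) amod \<Rightarrow> 'm set \<Rightarrow> ('a, 'm set) amod" where
  "qmod M S = \<lparr> mcarrier = mcoset M S ` mcarrier M,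
     madd = (\<lambda>X Y. mcoset M S (madd M (SOME u. u \<in> X) (SOME v. v \<in> Y))),
     mzero = mcoset M S (mzero M),
     msmul = (\<lambda>r X. mcoset M S (msmul M r (SOME u. u \<in> X))) \<rparr>"

definition coker :: "nat \<Rightarrow> nat \<Rightarrow> (nat \<Rightarrow> nat \<Rightarrow> 'a::comm_ring_1) \<Rightarrow> ('a, (nat \<Rightarrow> 'a) set) amod" where
  "coker m k D = qmod (fmod m) (matmap m k D ` mcarrier (fmod k))"

definition tmat :: "'a::comm_ring_1 \<Rightarrow> 'a \<Rightarrow> 'a \<Rightarrow> nat \<Rightarrow> nat \<Rightarrow> 'a" where
  "tmat p c q = (\<lambda>i j. if i = 0 \<and> j = 0 then p else if i = 0 \<and> j = 1 then c
                       else if i = 1 \<and> j = 1 then q else 0)"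

definition Gmod :: "'a::comm_ring_1 \<Rightarrow> 'a \<Rightarrow> 'a \<Rightarrow> ('a, (nat \<Rightarrow> 'a) set) amod" where
  "Gmod x y a = coker 2 2 (tmat x a y)"

definition Hmod :: "'a::comm_ring_1 \<Rightarrow> 'a \<Rightarrow> 'a \<Rightarrow> ('a, (nat \<Rightarrow> 'a) set) amod" where
  "Hmod x y a = coker 2 2 (tmat y (- a) x)"

definition weakly_regular :: "'a::comm_ring_1 \<Rightarrow> ('a, 'm) amod \<Rightarrow> bool" where
  "weakly_regular r M \<longleftrightarrow> inj_on (msmul M r) (mcarrier M)"

definition mregular :: "'a::comm_ring_1 \<Rightarrow> ('a, 'm) amod \<Rightarrow> bool" where
  "mregular r M \<longleftrightarrow> weakly_regular r M \<and> \<not> r dvd 1"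

definition indecomposable :: "('a::comm_ring_1, 'm) amod \<Rightarrow> bool" where
  "indecomposable M \<longleftrightarrow> mcarrier M \<noteq> {mzero M} \<and>
     (\<forall>S T. submodule S M \<and> submodule T M \<and> {madd M s t | s t. s \<in> S \<and> t \<in> T} = mcarrier M
        \<and> S \<inter> T = {mzero M} \<longrightarrow> S = {mzero M} \<or> T = {mzero M})"

definition msum :: "('a, 'm) amod \<Rightarrow> ('b \<Rightarrow> 'm) \<Rightarrow> 'b set \<Rightarrow> 'm" where
  "msum M f S = Finite_Set.fold (\<lambda>b acc. madd M (f b) acc) (mzero M) S"

definition mfree :: "('a::comm_ring_1, 'm) amod \<Rightarrow> bool" where
  "mfree M \<longleftrightarrow> (\<exists>B. B \<subseteq> mcarrier M \<and> (\<forall>u\<in>mcarrier M. \<exists>!c. (\<forall>e. e \<notin> B \<longrightarrow> c e = 0)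
      \<and> finite {e. c e \<noteq> 0} \<and> u = msum M (\<lambda>e. msmul M (c e) e) {e. c e \<noteq> 0}))"

definition mspan :: "('a::comm_ring_1, 'm) amod \<Rightarrow> 'm set \<Rightarrow> 'm set" where
  "mspan M S = \<Inter>{T. submodule T M \<and> S \<subseteq> T}"

definition fin_gen :: "('a::comm_ring_1, 'm) amod \<Rightarrow> bool" where
  "fin_gen M \<longleftrightarrow> (\<exists>S. finite S \<and> S \<subseteq> mcarrier M \<and> mspan M S = mcarrier M)"

text \<open>A resolution ... F_2 -d_2-> F_1 -d_1-> F_0 -eps-> M -> 0 by finitely generated free
  modules F_i = A^(n i); d i is an (n (i-1)) x (n i) matrix.\<close>
definition free_res :: "('a::comm_ring_1, 'm) amod \<Rightarrow> (nat \<Rightarrow> nat) \<Rightarrow> (nat \<Rightarrow> nat \<Rightarrow> nat \<Rightarrow> 'a)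
     \<Rightarrow> ((nat \<Rightarrow> 'a) \<Rightarrow> 'm) \<Rightarrow> bool" where
  "free_res M n d eps \<longleftrightarrow> mlinear eps (fmod (n 0)) M
     \<and> eps ` mcarrier (fmod (n 0)) = mcarrier M
     \<and> {v \<in> mcarrier (fmod (n 0)). eps v = mzero M} = matmap (n 0) (n 1) (d 1) ` mcarrier (fmod (n 1))
     \<and> (\<forall>i\<ge>1. {v \<in> mcarrier (fmod (n i)). matmap (n (i - 1)) (n i) (d i) v = mzero (fmod (n (i - 1)))}
              = matmap (n i) (n (Suc i)) (d (Suc i)) ` mcarrier (fmod (n (Suc i))))"

definition dual_pre :: "nat \<Rightarrow> nat \<Rightarrow> (nat \<Rightarrow> nat \<Rightarrow> 'a::comm_ring_1) \<Rightarrow> ((nat \<Rightarrow> 'a) \<Rightarrow> 'a) \<Rightarrow> ((nat \<Rightarrow> 'a) \<Rightarrow> 'a)" where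
  "dual_pre k m D phi = (\<lambda>v. if v \<in> mcarrier (fmod k) then phi (matmap m k D v) else 0)"

text \<open>Ext^i_A(M,A) = 0 (for i \<ge> 1): the i-th cohomology of Hom_A(F, A) vanishes,
  for every finite free resolution F of M.\<close>
definition ext_zero :: "nat \<Rightarrow> ('a::comm_ring_1, 'm) amod \<Rightarrow> bool" where
  "ext_zero i M \<longleftrightarrow> (\<forall>n d eps. free_res M n d eps \<longrightarrow>
     {phi \<in> mcarrier (hom_mod (fmod (n i)) ring_mod).
        dual_pre (n (Suc i)) (n i) (d (Suc i)) phi = mzero (hom_mod (fmod (n (Suc i))) ring_mod)}
     = dual_pre (n i) (n (i - 1)) (d i) ` mcarrier (hom_mod (fmod (n (i - 1))) ring_mod))"

definition dual_mod :: "('a::comm_ring_1, 'm) amod \<Rightarrow> ('a, 'm \<Rightarrow> 'a) amod" where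
  "dual_mod M = hom_mod M ring_mod"

definition bidual_map :: "('a::comm_ring_1, 'm) amod \<Rightarrow> 'm \<Rightarrow> (('m \<Rightarrow> 'a) \<Rightarrow> 'a)" where
  "bidual_map M u = (\<lambda>phi. if phi \<in> mcarrier (dual_mod M) then phi u else 0)"

definition totally_reflexive :: "('a::comm_ring_1, 'm) amod \<Rightarrow> bool" where
  "totally_reflexive M \<longleftrightarrow> fin_gen M
     \<and> (\<forall>i>0. ext_zero i M) \<and> (\<forall>i>0. ext_zero i (dual_mod M))
     \<and> mlinear (bidual_map M) M (dual_mod (dual_mod M))
     \<and> bij_betw (bidual_map M) (mcarrier M) (mcarrier (dual_mod (dual_mod M)))"

end

theory Submission
  imports Defs
begin

text \<open>
  Write $T(p,c,q)$ for the cokernel of the upper triangular matrix with rows $(p, c)$ and $(0, q)$, so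
  that $G_a = T(x,a,y)$ and $H_a = T(y,-a,x)$; the construction is symmetric under exchanging $x$
  and $y$, and the sign of the corner entry does not affect the isomorphism class.  A homomorphism out of
  $T(p,c,q)$ is a pair $(n_0, n_1)$ with $p n_0 = 0$ and $c n_0 + q n_1 = 0$.  Solving these equations
  in $T(x,c,y)$, where regularity of $c$ modulo $(x,y)$ and $(x) \<inter> (y) = 0$ enter, gives
  explicit generators and relations of the Hom modules, and hence all the Hom isomorphisms.

  The explicit homomorphisms also give the rest.  Every endomorphism of $G_a$ is multiplication by
  a ring element, so an idempotent endomorphism is trivial over a local ring.  The homomorphisms
  $G_{a_m} \<rightarrow> G_{a_n}$ with $m > n$, and those between a $G$ and an $H$, miss the second generator
  modulo the maximal ideal, so none of them is an isomorphism.  If $G_a$ were free, the first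
  generator, which $x$ annihilates, would lie in $y G_a$.  The two matrices alternate in a
  2-periodic free resolution with exact dual, which gives total reflexivity.
\<close>

subsection \<open>Modules and cokernels of triangular matrices\<close>

text \<open>Hom out of a triangular cokernel is again a triangular cokernel: the solutions
  \<open>(n0, n1)\<close> depend linearly on two parameters \<open>u\<close>, \<open>v\<close>, and
  the parameters of the zero map form the column span of a new triangular matrix, which can be read
  off. The corner \<open>-a\<close> in the matrix of \<open>H_a\<close> makes the two matrices
  multiply to zero in either order. In fact the kernel of each is the image of the other, so
  \<open>H_a\<close> is the first syzygy of \<open>G_a\<close> and conversely. Since
  \<open>H_a\<close> is the \<open>G\<close>-type module of the exchanged pair with corner
  \<open>-a\<close>, each fact about \<open>H\<close> is the fact about \<open>G\<close> for
  \<open>(y, x)\<close> and \<open>-a\<close>. Two features of the definitions cost work. The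
  vanishing of Ext is demanded for every finite free resolution, so a convenient resolution has to
  be compared with an arbitrary one up to homotopy. And the dual of a cokernel is a module of
  functions, so its Ext is reached only through an isomorphism with a cokernel.\<close>

locale amodule =
  fixes M :: "('a::comm_ring_1, 'm) amod"
  assumes add_closed: "\<lbrakk>u \<in> mcarrier M; v \<in> mcarrier M\<rbrakk> \<Longrightarrow> madd M u v \<in> mcarrier M"
    and zero_closed: "mzero M \<in> mcarrier M"
    and smul_closed: "u \<in> mcarrier M \<Longrightarrow> msmul M r u \<in> mcarrier M"
    and add_assoc: "\<lbrakk>u \<in> mcarrier M; v \<in> mcarrier M; w \<in> mcarrier M\<rbrakk>
      \<Longrightarrow> madd M (madd M u v) w = madd M u (madd M v w)"
    and add_comm: "\<lbrakk>u \<in> mcarrier M; v \<in> mcarrier M\<rbrakk> \<Longrightarrow> madd M u v = madd M v u"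
    and add_zero: "u \<in> mcarrier M \<Longrightarrow> madd M u (mzero M) = u"
    and smul_add: "\<lbrakk>u \<in> mcarrier M; v \<in> mcarrier M\<rbrakk>
      \<Longrightarrow> msmul M r (madd M u v) = madd M (msmul M r u) (msmul M r v)"
    and add_smul: "u \<in> mcarrier M \<Longrightarrow> msmul M (r + s) u = madd M (msmul M r u) (msmul M s u)"
    and smul_smul: "u \<in> mcarrier M \<Longrightarrow> msmul M r (msmul M s u) = msmul M (r * s) u"
    and one_smul: "u \<in> mcarrier M \<Longrightarrow> msmul M 1 u = u"
    and zero_smul: "u \<in> mcarrier M \<Longrightarrow> msmul M 0 u = mzero M"
begin

lemma smul_zero: "msmul M r (mzero M) = mzero M"
  by (metis zero_closed zero_smul smul_smul mult_zero_right)

lemma add_left_commute: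
  "\<lbrakk>u \<in> mcarrier M; v \<in> mcarrier M; w \<in> mcarrier M\<rbrakk>
    \<Longrightarrow> madd M u (madd M v w) = madd M v (madd M u w)"
  by (metis add_assoc add_comm)

text \<open>The locale postulates no additive inverses; together with \<open>zero_smul\<close> the
  scalar \<open>- 1\<close> supplies them.\<close>

lemma add_neg: "u \<in> mcarrier M \<Longrightarrow> madd M u (msmul M (- 1) u) = mzero M"
  using add_smul[of u 1 "-1"] by (simp add: one_smul zero_smul)

lemma add_left_cancel:
  assumes "u \<in> mcarrier M" "v \<in> mcarrier M" "w \<in> mcarrier M" "madd M u v = madd M u w"
  shows "v = w"
proof -
  have "madd M (msmul M (- 1) u) (madd M u z) = z" if "z \<in> mcarrier M" for z
    using that assms(1) by (metis add_assoc add_comm add_neg add_zero smul_closed zero_closed)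
  then show ?thesis using assms by metis
qed

end

lemma amodule_ring_mod: "amodule (ring_mod :: ('a::comm_ring_1, 'a) amod)"
  by unfold_locales (auto simp: ring_mod_def algebra_simps)

lemma amodule_fmod: "amodule (fmod n :: ('a::comm_ring_1, nat \<Rightarrow> 'a) amod)"
  by unfold_locales (auto simp: fmod_def algebra_simps)

lemma (in amodule) mcoset_eq_iff:
  assumes S: "submodule S M" and u: "u \<in> mcarrier M" and v: "v \<in> mcarrier M"
  shows "mcoset M S u = mcoset M S v \<longleftrightarrow> (\<exists>s\<in>S. u = madd M v s)"
proof
  have z: "mzero M \<in> S" using S by (auto simp: submodule_def)
  assume "mcoset M S u = mcoset M S v"
  moreover have "u \<in> mcoset M S u" using z add_zero[OF u] by (force simp: mcoset_def)
  ultimately show "\<exists>s\<in>S. u = madd M v s" by (auto simp: mcoset_def)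
next
  have sub: "S \<subseteq> mcarrier M" using S by (auto simp: submodule_def)
  assume "\<exists>s\<in>S. u = madd M v s"
  then obtain s where s: "s \<in> S" and us: "u = madd M v s" by blast
  have sM: "s \<in> mcarrier M" using s sub by blast
  have "madd M u t \<in> mcoset M S v" if "t \<in> S" for t
  proof -
    have "madd M s t \<in> S" using S s that by (auto simp: submodule_def)
    moreover have "madd M u t = madd M v (madd M s t)"
      using us that v sM sub by (auto simp: add_assoc)
    ultimately show ?thesis by (auto simp: mcoset_def)
  qed
  moreover have "madd M v t \<in> mcoset M S u" if "t \<in> S" for t
  proof -
    let ?n = "madd M (msmul M (- 1) s) t"
    have tM: "t \<in> mcarrier M" using that sub by blast
    have "?n \<in> S" using S s that by (auto simp: submodule_def)
    moreover have "madd M u ?n = madd M v (madd M (madd M s (msmul M (- 1) s)) t)"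
      using us tM v sM by (simp add: add_assoc smul_closed add_closed)
    then have "madd M u ?n = madd M v t"
      using tM by (simp add: add_neg[OF sM] add_comm[OF zero_closed] add_zero)
    ultimately show ?thesis by (force simp: mcoset_def)
  qed
  ultimately show "mcoset M S u = mcoset M S v" by (auto simp: mcoset_def)
qed

text \<open>\<open>qmod\<close> computes with representatives picked by \<open>SOME\<close>. They
  differ from the given ones by elements of the submodule \<open>S\<close>, which the resulting
  coset absorbs.\<close>

lemma (in amodule) qmod_simps:
  assumes S: "submodule S M"
  shows "\<lbrakk>u \<in> mcarrier M; v \<in> mcarrier M\<rbrakk>
      \<Longrightarrow> madd (qmod M S) (mcoset M S u) (mcoset M S v) = mcoset M S (madd M u v)"
    and "u \<in> mcarrier M \<Longrightarrow> msmul (qmod M S) r (mcoset M S u) = mcoset M S (msmul M r u)"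
proof -
  have sub: "S \<subseteq> mcarrier M" using S by (auto simp: submodule_def)
  have rep: "\<exists>s\<in>S. (SOME w. w \<in> mcoset M S u) = madd M u s" if "u \<in> mcarrier M" for u
  proof -
    have "mzero M \<in> S" using S by (auto simp: submodule_def)
    then have "u \<in> mcoset M S u" using add_zero[OF that] by (force simp: mcoset_def)
    then have "(SOME w. w \<in> mcoset M S u) \<in> mcoset M S u" by (rule someI)
    then show ?thesis by (auto simp: mcoset_def)
  qed
  show "madd (qmod M S) (mcoset M S u) (mcoset M S v) = mcoset M S (madd M u v)"
    if u: "u \<in> mcarrier M" and v: "v \<in> mcarrier M"
  proof -
    obtain s t where st: "s \<in> S" "t \<in> S" "(SOME w. w \<in> mcoset M S u) = madd M u s"
      "(SOME w. w \<in> mcoset M S v) = madd M v t" using rep u v by blast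
    have M: "s \<in> mcarrier M" "t \<in> mcarrier M" using st sub by auto
    have "madd M (madd M u s) (madd M v t) = madd M (madd M u v) (madd M s t)"
      using u v M by (simp add: add_assoc add_closed add_left_commute)
    moreover have "madd M s t \<in> S" using S st by (auto simp: submodule_def)
    ultimately have "mcoset M S (madd M (madd M u s) (madd M v t)) = mcoset M S (madd M u v)"
      using mcoset_eq_iff[OF S, THEN iffD2, of "madd M (madd M u s) (madd M v t)" "madd M u v"] u v M
      by (auto simp: add_closed)
    then show ?thesis by (simp add: qmod_def st)
  qed
  show "msmul (qmod M S) r (mcoset M S u) = mcoset M S (msmul M r u)"
    if u: "u \<in> mcarrier M"
  proof -
    obtain s where st: "s \<in> S" "(SOME w. w \<in> mcoset M S u) = madd M u s"
      using rep u by blast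
    have M: "s \<in> mcarrier M" using st sub by auto
    have "msmul M r s \<in> S" using S st by (auto simp: submodule_def)
    then have "mcoset M S (msmul M r (madd M u s)) = mcoset M S (msmul M r u)"
      using mcoset_eq_iff[OF S, THEN iffD2, of "msmul M r (madd M u s)" "msmul M r u"] u M
      by (auto simp: add_closed smul_closed smul_add)
    then show ?thesis by (simp add: qmod_def st)
  qed
qed

abbreviation tri :: "'a::comm_ring_1 \<Rightarrow> 'a \<Rightarrow> 'a \<Rightarrow> ('a, (nat \<Rightarrow> 'a) set) amod" where
  "tri p c q \<equiv> coker 2 2 (tmat p c q)"

definition vec2 :: "'a::comm_ring_1 \<Rightarrow> 'a \<Rightarrow> nat \<Rightarrow> 'a" where
  "vec2 u v = (\<lambda>i. if i = 0 then u else if i = 1 then v else 0)"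

text \<open>The class of the column vector \<open>(u, v)\<close>. The classes of
  \<open>(1, 0)\<close> and \<open>(0, 1)\<close>, called first and second generator below, generate
  the cokernel.\<close>

definition cl :: "'a::comm_ring_1 \<Rightarrow> 'a \<Rightarrow> 'a \<Rightarrow> 'a \<Rightarrow> 'a \<Rightarrow> (nat \<Rightarrow> 'a) set" where
  "cl p c q u v = mcoset (fmod 2) (matmap 2 2 (tmat p c q) ` mcarrier (fmod 2)) (vec2 u v)"

lemma fmod2_iff: "w \<in> mcarrier (fmod 2) \<longleftrightarrow> (\<exists>u v. w = vec2 u v)"
proof
  assume "w \<in> mcarrier (fmod 2)"
  then have "w i = vec2 (w 0) (w 1) i" for i
    by (cases "i < 2") (auto simp: fmod_def vec2_def less_2_cases_iff)
  then show "\<exists>u v. w = vec2 u v" by blast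
next
  assume "\<exists>u v. w = vec2 u v"
  then obtain u v where "w = vec2 u v" by blast
  then show "w \<in> mcarrier (fmod 2)" by (simp add: fmod_def vec2_def)
qed

lemma vec2_nth [simp]: "vec2 u v 0 = u" "vec2 u v (Suc 0) = v"
  by (simp_all add: vec2_def)

lemma vec2_eq_iff [simp]: "vec2 u v = vec2 u' v' \<longleftrightarrow> u = u' \<and> v = v'"
  by (metis vec2_nth)

text \<open>Valid for every \<open>n\<close>, because only the carrier of \<open>fmod n\<close>
  depends on \<open>n\<close>; the operations are pointwise.\<close>

lemma fmod_vec2 [simp]:
  "madd (fmod n) (vec2 u v) (vec2 u' v') = vec2 (u + u') (v + v')"
  "msmul (fmod n) r (vec2 u v) = vec2 (r * u) (r * v)"
  "mzero (fmod n) = vec2 0 0"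
  by (simp_all add: fmod_def vec2_def fun_eq_iff)

lemma matmap_tmat [simp]: "matmap 2 2 (tmat p c q) (vec2 u v) = vec2 (p * u + c * v) (q * v)"
  by (auto simp: matmap_def tmat_def vec2_def numeral_2_eq_2 fun_eq_iff)

lemma image_tmat:
  "w \<in> matmap 2 2 (tmat p c q) ` mcarrier (fmod 2) \<longleftrightarrow> (\<exists>s t. w = vec2 (p * s + c * t) (q * t))"
  by (auto simp: image_iff Bex_def fmod2_iff) (metis matmap_tmat)+

lemma submodule_tmat: "submodule (matmap 2 2 (tmat p c q) ` mcarrier (fmod 2)) (fmod 2)"
proof -
  have "\<exists>s'' t''. (p * s + c * t) + (p * s' + c * t') = p * s'' + c * t'' \<and> q * t + q * t' = q * t''"
    for s t s' t'
    by (rule exI[of _ "s + s'"], rule exI[of _ "t + t'"]) (simp add: algebra_simps)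
  moreover have "\<exists>s'' t''. r * (p * s + c * t) = p * s'' + c * t'' \<and> r * (q * t) = q * t''" for r s t
    by (rule exI[of _ "r * s"], rule exI[of _ "r * t"]) (simp add: algebra_simps)
  moreover have "\<exists>s t. 0 = p * s + c * t \<and> 0 = q * t"
    by (rule exI[of _ 0], rule exI[of _ 0]) simp
  ultimately show ?thesis
    unfolding submodule_def subset_iff by (auto simp: image_tmat fmod2_iff)
qed

lemma tri_carrier: "X \<in> mcarrier (tri p c q) \<longleftrightarrow> (\<exists>u v. X = cl p c q u v)"
proof -
  have "mcarrier (tri p c q) = mcoset (fmod 2) (matmap 2 2 (tmat p c q) ` mcarrier (fmod 2)) ` mcarrier (fmod 2)"
    by (simp add: coker_def qmod_def)
  then show ?thesis by (auto simp: cl_def image_iff Bex_def fmod2_iff)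
qed

lemma cl_carrier [simp]: "cl p c q u v \<in> mcarrier (tri p c q)"
  using tri_carrier by blast

lemma cl_eq_iff:
  "cl p c q u v = cl p c q u' v' \<longleftrightarrow> (\<exists>s t. u - u' = p * s + c * t \<and> v - v' = q * t)"
proof -
  have "cl p c q u v = cl p c q u' v' \<longleftrightarrow> (\<exists>s t. u = u' + (p * s + c * t) \<and> v = v' + q * t)"
    unfolding cl_def
    apply (subst amodule.mcoset_eq_iff[OF amodule_fmod submodule_tmat])
      apply (auto simp: fmod2_iff Bex_def image_tmat)
    apply (metis fmod_vec2(1))+
    done
  then show ?thesis by (simp add: diff_eq_eq add.commute)
qed

lemma tri_add [simp]: "madd (tri p c q) (cl p c q u v) (cl p c q u' v') = cl p c q (u + u') (v + v')"
  unfolding cl_def coker_def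
  by (subst amodule.qmod_simps[OF amodule_fmod submodule_tmat]) (auto simp: fmod2_iff)

lemma tri_smul [simp]: "msmul (tri p c q) r (cl p c q u v) = cl p c q (r * u) (r * v)"
  unfolding cl_def coker_def
  by (subst amodule.qmod_simps[OF amodule_fmod submodule_tmat]) (auto simp: fmod2_iff)

lemma tri_zero [simp]: "mzero (tri p c q) = cl p c q 0 0"
  by (simp add: cl_def coker_def qmod_def)

lemma amodule_tri: "amodule (tri p c q)"
proof
  fix u v w r s
  assume "u \<in> mcarrier (tri p c q)"
  then obtain u0 u1 where u: "u = cl p c q u0 u1" by (auto simp: tri_carrier)
  show "msmul (tri p c q) r u \<in> mcarrier (tri p c q)" unfolding u tri_smul by simp
  show "madd (tri p c q) u (mzero (tri p c q)) = u"
    "msmul (tri p c q) (r + s) u = madd (tri p c q) (msmul (tri p c q) r u) (msmul (tri p c q) s u)"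
    "msmul (tri p c q) r (msmul (tri p c q) s u) = msmul (tri p c q) (r * s) u"
    "msmul (tri p c q) 1 u = u" "msmul (tri p c q) 0 u = mzero (tri p c q)"
    by (simp_all add: u algebra_simps)
  assume "v \<in> mcarrier (tri p c q)"
  then obtain v0 v1 where v: "v = cl p c q v0 v1" by (auto simp: tri_carrier)
  show "madd (tri p c q) u v \<in> mcarrier (tri p c q)" unfolding u v tri_add by simp
  show "madd (tri p c q) u v = madd (tri p c q) v u"
    "msmul (tri p c q) r (madd (tri p c q) u v) = madd (tri p c q) (msmul (tri p c q) r u) (msmul (tri p c q) r v)"
    by (simp_all add: u v algebra_simps)
  assume "w \<in> mcarrier (tri p c q)"
  then obtain w0 w1 where w: "w = cl p c q w0 w1" by (auto simp: tri_carrier)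
  show "madd (tri p c q) (madd (tri p c q) u v) w = madd (tri p c q) u (madd (tri p c q) v w)"
    by (simp add: u v w algebra_simps)
qed simp

lemma cl_eq_zero_iff: "cl p c q u v = cl p c q 0 0 \<longleftrightarrow> (\<exists>s t. u = p * s + c * t \<and> v = q * t)"
  by (simp add: cl_eq_iff)

text \<open>Weak regularity of \<open>c\<close> on A/(x,y), in terms of elements. Being a non-unit
  is kept apart, so that the notion contains 1, the empty product, and is closed under
  products.\<close>

definition regular_mod :: "'a::comm_ring_1 \<Rightarrow> 'a \<Rightarrow> 'a \<Rightarrow> bool" where
  "regular_mod x y c \<longleftrightarrow> (\<forall>u r s. c * u = x * r + y * s \<longrightarrow> (\<exists>r' s'. u = x * r' + y * s'))"

lemma mregular_imp_regular_mod:
  assumes "mregular c (qmod ring_mod {x * r + y * s | r s. True})"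
  shows "regular_mod x y c"
  unfolding regular_mod_def
proof (intro allI impI)
  let ?I = "{x * r + y * s | r s. True}"
  fix u r s assume u: "c * u = x * r + y * s"
  have I: "submodule ?I ring_mod"
  proof -
    have "\<exists>r'' s''. (x * r + y * s) + (x * r' + y * s') = x * r'' + y * s''" for r s r' s'
      by (rule exI[of _ "r + r'"], rule exI[of _ "s + s'"]) (simp add: algebra_simps)
    moreover have "\<exists>r'' s''. t * (x * r + y * s) = x * r'' + y * s''" for r s t
      by (rule exI[of _ "t * r"], rule exI[of _ "t * s"]) (simp add: algebra_simps)
    moreover have "\<exists>r s. 0 = x * r + y * s" by (rule exI[of _ 0], rule exI[of _ 0]) simp
    ultimately show ?thesis by (auto simp: submodule_def ring_mod_def)
  qed
  let ?k = "mcoset ring_mod ?I"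
  have eq: "?k v = ?k w \<longleftrightarrow> (\<exists>i\<in>?I. v = w + i)" for v w
    using amodule.mcoset_eq_iff[OF amodule_ring_mod I, of v w] by (simp add: ring_mod_def)
  have sm: "msmul (qmod ring_mod ?I) c (?k v) = ?k (c * v)" for v
    using amodule.qmod_simps(2)[OF amodule_ring_mod I, of v c] by (simp add: ring_mod_def)
  have "?k (c * u) = ?k (c * 0)" unfolding eq using u by auto
  then have "msmul (qmod ring_mod ?I) c (?k u) = msmul (qmod ring_mod ?I) c (?k 0)" by (simp only: sm)
  moreover have "?k v \<in> mcarrier (qmod ring_mod ?I)" for v by (simp add: qmod_def ring_mod_def)
  ultimately have "?k u = ?k 0"
    using assms unfolding mregular_def weakly_regular_def by (meson inj_onD)
  then show "\<exists>r' s'. u = x * r' + y * s'" unfolding eq by auto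
qed

lemma regular_mod_mult:
  assumes "regular_mod x y c" "regular_mod x y d"
  shows "regular_mod x y (c * d)"
  unfolding regular_mod_def
proof (intro allI impI)
  fix u r s assume "c * d * u = x * r + y * s"
  then obtain r' s' where "d * u = x * r' + y * s'"
    using assms(1) unfolding regular_mod_def mult.assoc by blast
  then show "\<exists>r' s'. u = x * r' + y * s'"
    using assms(2) unfolding regular_mod_def by blast
qed

lemma regular_mod_swap: "regular_mod x y c \<Longrightarrow> regular_mod y x c"
  unfolding regular_mod_def by (metis add.commute)

lemma regular_mod_1: "regular_mod x y 1"
  unfolding regular_mod_def by auto

lemma regular_mod_minus:
  assumes "regular_mod x y c" shows "regular_mod x y (- c)"
  unfolding regular_mod_def
proof (intro allI impI)
  fix u r s assume "- c * u = x * r + y * s"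
  then have "c * u = x * (- r) + y * (- s)" by (simp add: algebra_simps neg_eq_iff_add_eq_0 eq_neg_iff_add_eq_0)
  then show "\<exists>r' s'. u = x * r' + y * s'" using assms unfolding regular_mod_def by blast
qed

lemma regular_mod_prod:
  assumes "finite S" "\<And>i. i \<in> S \<Longrightarrow> regular_mod x y (b i)"
  shows "regular_mod x y (\<Prod>i\<in>S. b i)"
  using assms by (induction S) (auto intro: regular_mod_1 regular_mod_mult)

lemma mem_pideal: "u \<in> pideal r \<longleftrightarrow> r dvd u"
  by (auto simp: pideal_def)

text \<open>Zorn's lemma puts every non-unit into some maximal ideal, and there is only one;
  conversely a proper ideal contains no unit.\<close>

lemma local_ring_nonunits:
  assumes "local_ring TYPE('a::comm_ring_1)"
  obtains m :: "'a::comm_ring_1 set" where "ring_ideal m" "\<And>r. r \<in> m \<longleftrightarrow> \<not> r dvd 1"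
proof -
  obtain m :: "'a set" where m: "maximal_ideal m" and uniq: "\<And>n. maximal_ideal n \<Longrightarrow> n = m"
    using assms unfolding local_ring_def by blast
  have mi: "ring_ideal m" using m by (simp add: maximal_ideal_def)
  have full: "J = UNIV" if "ring_ideal J" "1 \<in> J" for J :: "'a set"
    using that unfolding ring_ideal_def by (metis UNIV_eq_I mult.right_neutral)
  have unit: "1 \<in> J" if "ring_ideal J" "r \<in> J" "r dvd 1" for J :: "'a set" and r
    using that unfolding ring_ideal_def dvd_def by (metis mult.commute)
  have in_m: "r \<in> m" if r: "\<not> r dvd 1" for r
  proof -
    \<comment> \<open>An ideal outside \<open>?A\<close> that contains \<open>r\<close> contains 1
      and is the whole ring, so a maximal element of \<open>?A\<close> is a maximal ideal.\<close>
    let ?A = "{J. ring_ideal J \<and> r \<in> J \<and> 1 \<notin> J}"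
    have "pideal r \<in> ?A"
    proof -
      have "ring_ideal (pideal r)" by (simp add: ring_ideal_def mem_pideal)
      then show ?thesis using r by (simp add: mem_pideal)
    qed
    then have "?A \<noteq> {}" by blast
    moreover have "\<Union>C \<in> ?A" if "C \<noteq> {}" "subset.chain ?A C" for C
    proof -
      have C: "\<And>J. J \<in> C \<Longrightarrow> ring_ideal J \<and> r \<in> J \<and> 1 \<notin> J"
        using that(2) unfolding subset.chain_def by blast
      have lin: "\<And>J K. J \<in> C \<Longrightarrow> K \<in> C \<Longrightarrow> J \<subseteq> K \<or> K \<subseteq> J"
        using that(2) unfolding subset_chain_def by blast
      have "u + v \<in> \<Union>C" if "u \<in> J" "J \<in> C" "v \<in> K" "K \<in> C" for u v J K
      proof -
        obtain L where "L \<in> C" "u \<in> L" "v \<in> L"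
          using \<open>u \<in> J\<close> \<open>J \<in> C\<close> \<open>v \<in> K\<close> \<open>K \<in> C\<close> lin[of J K] by blast
        then show ?thesis using C[of L] by (auto simp: ring_ideal_def)
      qed
      then have "\<forall>u\<in>\<Union>C. \<forall>v\<in>\<Union>C. u + v \<in> \<Union>C" by blast
      moreover have "\<forall>t. \<forall>u\<in>\<Union>C. t * u \<in> \<Union>C"
        using C unfolding ring_ideal_def by blast
      moreover have "0 \<in> \<Union>C" using C that(1) unfolding ring_ideal_def by blast
      ultimately have "ring_ideal (\<Union>C)" unfolding ring_ideal_def by simp
      then show ?thesis using C that(1) by auto
    qed
    ultimately obtain J where J: "J \<in> ?A" and max: "\<And>K. K \<in> ?A \<Longrightarrow> J \<subseteq> K \<Longrightarrow> K = J"
      using subset_Zorn_nonempty[of ?A] by blast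
    have "K = J \<or> K = UNIV" if "ring_ideal K" "J \<subseteq> K" for K
      using J max[of K] full[of K] that by auto
    then have "maximal_ideal J"
      unfolding maximal_ideal_def using J by auto
    then show ?thesis using uniq J by blast
  qed
  have "1 \<notin> m" using full[OF mi] m by (auto simp: maximal_ideal_def)
  then have "\<not> r dvd 1" if "r \<in> m" for r
    using unit[OF mi \<open>r \<in> m\<close>] by blast
  then show thesis using in_m that[OF mi] by meson
qed

subsection \<open>Homomorphisms out of a triangular cokernel\<close>

text \<open>Sends the two generators to \<open>n0\<close> and \<open>n1\<close>, computed on a
  chosen representative. The value outside the carrier is the one that \<open>hom_mod\<close>
  prescribes.\<close>

definition gen_hom :: "'a::comm_ring_1 \<Rightarrow> 'a \<Rightarrow> 'a \<Rightarrow> ('a, 'n) amod \<Rightarrow> 'n \<Rightarrow> 'n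
    \<Rightarrow> (nat \<Rightarrow> 'a) set \<Rightarrow> 'n" where
  "gen_hom p c q N n0 n1 X = (if X \<in> mcarrier (tri p c q)
     then (case SOME (u, v). X = cl p c q u v of (u, v) \<Rightarrow> madd N (msmul N u n0) (msmul N v n1))
     else mzero N)"

text \<open>One equation for each column of the matrix: \<open>(p, 0)\<close> and
  \<open>(c, q)\<close> are the relations between the two generators.\<close>

definition tri_rel :: "'a::comm_ring_1 \<Rightarrow> 'a \<Rightarrow> 'a \<Rightarrow> ('a, 'n) amod \<Rightarrow> 'n \<Rightarrow> 'n \<Rightarrow> bool" where
  "tri_rel p c q N n0 n1 \<longleftrightarrow> n0 \<in> mcarrier N \<and> n1 \<in> mcarrier N \<and> msmul N p n0 = mzero N
     \<and> madd N (msmul N c n0) (msmul N q n1) = mzero N"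

text \<open>Two representatives of a class differ by \<open>s\<close> times the first column plus
  \<open>t\<close> times the second, and \<open>tri_rel\<close> says that both columns are sent to
  zero.\<close>

lemma (in amodule) gen_hom_cl:
  assumes "tri_rel p c q M n0 n1"
  shows "gen_hom p c q M n0 n1 (cl p c q u v) = madd M (msmul M u n0) (msmul M v n1)"
proof -
  have n: "n0 \<in> mcarrier M" "n1 \<in> mcarrier M" "msmul M p n0 = mzero M"
    "madd M (msmul M c n0) (msmul M q n1) = mzero M"
    using assms by (auto simp: tri_rel_def)
  obtain u' v' where uv: "(SOME (u', v'). cl p c q u v = cl p c q u' v') = (u', v')"
    by (metis surj_pair)
  have "case SOME (u', v'). cl p c q u v = cl p c q u' v' of (u', v') \<Rightarrow> cl p c q u v = cl p c q u' v'"
    by (rule someI[of _ "(u, v)"]) simp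
  then have "cl p c q u v = cl p c q u' v'" using uv by simp
  then obtain s t where st: "u - u' = p * s + c * t" "v - v' = q * t" by (auto simp: cl_eq_iff)
  have u: "u = u' + (s * p + t * c)" and v: "v = v' + t * q"
    using st by (simp_all add: algebra_simps)
  have su: "msmul M u n0 = madd M (msmul M u' n0) (msmul M t (msmul M c n0))"
  proof -
    have "msmul M (s * p) n0 = mzero M" using n by (metis smul_smul smul_zero)
    then show ?thesis using n
      unfolding u by (simp add: add_smul smul_smul smul_closed add_closed zero_closed add_comm[of "mzero M"] add_zero)
  qed
  have sv: "msmul M v n1 = madd M (msmul M v' n1) (msmul M t (msmul M q n1))"
    using n unfolding v by (simp add: add_smul smul_smul)
  have "madd M (msmul M u n0) (msmul M v n1)
      = madd M (madd M (msmul M u' n0) (msmul M v' n1))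
               (madd M (msmul M t (msmul M c n0)) (msmul M t (msmul M q n1)))"
    unfolding su sv using n by (simp add: add_assoc add_left_commute smul_closed add_closed)
  also have "madd M (msmul M t (msmul M c n0)) (msmul M t (msmul M q n1)) = mzero M"
    using n by (metis smul_add smul_closed smul_zero)
  finally show ?thesis
    using n by (simp add: gen_hom_def uv smul_closed add_closed add_zero)
qed

lemma (in amodule) gen_hom_closed:
  assumes "tri_rel p c q M n0 n1"
  shows "gen_hom p c q M n0 n1 \<in> mcarrier (hom_mod (tri p c q) M)"
proof -
  have n: "n0 \<in> mcarrier M" "n1 \<in> mcarrier M" using assms by (auto simp: tri_rel_def)
  have "mlinear (gen_hom p c q M n0 n1) (tri p c q) M"
    unfolding mlinear_def Ball_def tri_carrier
  proof (intro conjI allI impI; (elim exE)?; simp add: gen_hom_cl[OF assms])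
    fix u v u' v' r
    show "madd M (msmul M u n0) (msmul M v n1) \<in> mcarrier M" using n by (simp add: smul_closed add_closed)
    show "madd M (msmul M (u + u') n0) (msmul M (v + v') n1) =
      madd M (madd M (msmul M u n0) (msmul M v n1)) (madd M (msmul M u' n0) (msmul M v' n1))"
      using n by (simp add: add_smul add_assoc add_left_commute smul_closed add_closed)
    show "madd M (msmul M (r * u) n0) (msmul M (r * v) n1) = msmul M r (madd M (msmul M u n0) (msmul M v n1))"
      using n by (simp add: smul_add smul_smul smul_closed)
  qed
  then show ?thesis by (simp add: hom_mod_def gen_hom_def)
qed

lemma (in amodule) mlinear_tri:
  assumes h: "mlinear h (tri p c q) M"
  shows "tri_rel p c q M (h (cl p c q 1 0)) (h (cl p c q 0 1))"
    and "h (cl p c q u v) = madd M (msmul M u (h (cl p c q 1 0))) (msmul M v (h (cl p c q 0 1)))"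
proof -
  have hc: "h (cl p c q u v) \<in> mcarrier M" for u v using h by (simp add: mlinear_def)
  have add: "h (cl p c q (u + u') (v + v')) = madd M (h (cl p c q u v)) (h (cl p c q u' v'))" for u v u' v'
    using h unfolding mlinear_def by (metis cl_carrier tri_add)
  have smul: "h (cl p c q (r * u) (r * v)) = msmul M r (h (cl p c q u v))" for r u v
    using h unfolding mlinear_def by (metis cl_carrier tri_smul)
  show lin: "h (cl p c q u v) = madd M (msmul M u (h (cl p c q 1 0))) (msmul M v (h (cl p c q 0 1)))" for u v
    using add[of u 0 0 v] smul[of u 1 0] smul[of v 0 1] by simp
  have zero: "h (cl p c q 0 0) = mzero M"
    using smul[of 0 0 0] hc by (simp add: zero_smul)
  have "cl p c q p 0 = cl p c q 0 0" unfolding cl_eq_zero_iff by (rule exI[of _ 1], rule exI[of _ 0]) simp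
  moreover have "cl p c q c q = cl p c q 0 0" unfolding cl_eq_zero_iff by (rule exI[of _ 0], rule exI[of _ 1]) simp
  ultimately show "tri_rel p c q M (h (cl p c q 1 0)) (h (cl p c q 0 1))"
    unfolding tri_rel_def using hc smul[of p 1 0] lin[of c q] zero by simp
qed

lemma mlinear_closed: "mlinear f M N \<Longrightarrow> u \<in> mcarrier M \<Longrightarrow> f u \<in> mcarrier N"
  by (simp add: mlinear_def)

text \<open>The first isomorphism theorem in coordinates. By \<open>rel\<close> and
  \<open>surj\<close>, the linear map from \<open>(u, v)\<close> to \<open>(F u v, G u v)\<close>
  sends A^2 onto the admissible images of the generators, that is, onto Hom; by
  \<open>kernel\<close> its kernel is the column span of the matrix with entries \<open>p'\<close>,
  \<open>c'\<close>, \<open>q'\<close>.\<close>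

lemma miso_hom_tri:
  fixes N :: "('a::comm_ring_1, 'n) amod" and F G :: "'a \<Rightarrow> 'a \<Rightarrow> 'n"
  assumes N: "amodule N"
    and rel: "\<And>u v. tri_rel p c q N (F u v) (G u v)"
    and F_add: "\<And>u v u' v'. F (u + u') (v + v') = madd N (F u v) (F u' v')"
    and G_add: "\<And>u v u' v'. G (u + u') (v + v') = madd N (G u v) (G u' v')"
    and F_smul: "\<And>r u v. F (r * u) (r * v) = msmul N r (F u v)"
    and G_smul: "\<And>r u v. G (r * u) (r * v) = msmul N r (G u v)"
    and surj: "\<And>n0 n1. tri_rel p c q N n0 n1 \<Longrightarrow> \<exists>u v. n0 = F u v \<and> n1 = G u v"
    and kernel: "\<And>u v. F u v = mzero N \<and> G u v = mzero N \<longleftrightarrow> (\<exists>s t. u = p' * s + c' * t \<and> v = q' * t)"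
  shows "miso (hom_mod (tri p c q) N) (tri p' c' q')"
proof -
  interpret amodule N by (rule N)
  let ?e0 = "cl p c q 1 0" and ?e1 = "cl p c q 0 1" and ?H = "hom_mod (tri p c q) N"
  have FG: "F u v \<in> mcarrier N" "G u v \<in> mcarrier N" for u v using rel[of u v] by (auto simp: tri_rel_def)
  have eq: "F u v = F u' v' \<and> G u v = G u' v' \<longleftrightarrow> cl p' c' q' u v = cl p' c' q' u' v'" for u v u' v'
  proof -
    have "F u v = madd N (F u' v') (F (u - u') (v - v'))" "G u v = madd N (G u' v') (G (u - u') (v - v'))"
      using F_add[of u' "u - u'" v' "v - v'"] G_add[of u' "u - u'" v' "v - v'"] by simp_all
    then have "F u v = F u' v' \<longleftrightarrow> F (u - u') (v - v') = mzero N"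
      "G u v = G u' v' \<longleftrightarrow> G (u - u') (v - v') = mzero N"
      using add_left_cancel add_zero FG zero_closed by metis+
    then show ?thesis using kernel[of "u - u'" "v - v'"] by (simp add: cl_eq_iff)
  qed
  \<comment> \<open>The inverse of the parametrisation: choose parameters for \<open>h\<close> and
    take their class, which by \<open>eq\<close> does not depend on the choice.\<close>
  define f where "f h = (case SOME (u, v). h ?e0 = F u v \<and> h ?e1 = G u v of (u, v) \<Rightarrow> cl p' c' q' u v)" for h
  have H: "mlinear h (tri p c q) N" if "h \<in> mcarrier ?H" for h using that by (simp add: hom_mod_def)
  have f: "f h = cl p' c' q' u v" if "h ?e0 = F u v" "h ?e1 = G u v" for h u v
  proof -
    obtain u' v' where uv: "(SOME (u, v). h ?e0 = F u v \<and> h ?e1 = G u v) = (u', v')"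
      by (metis surj_pair)
    have "case SOME (u, v). h ?e0 = F u v \<and> h ?e1 = G u v of (u, v) \<Rightarrow> h ?e0 = F u v \<and> h ?e1 = G u v"
      by (rule someI[of _ "(u, v)"]) (simp add: that)
    then have "h ?e0 = F u' v' \<and> h ?e1 = G u' v'" using uv by simp
    then have "cl p' c' q' u' v' = cl p' c' q' u v" using eq that by metis
    then show ?thesis by (simp add: f_def uv)
  qed
  have ex: "\<exists>u v. h ?e0 = F u v \<and> h ?e1 = G u v" if "h \<in> mcarrier ?H" for h
    using surj[OF mlinear_tri(1)[OF H[OF that]]] .
  have e: "?e0 \<in> mcarrier (tri p c q)" "?e1 \<in> mcarrier (tri p c q)" by simp_all
  have lin: "mlinear f ?H (tri p' c' q')"
    unfolding mlinear_def
  proof (intro conjI ballI allI)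
    fix h k r assume h: "h \<in> mcarrier ?H"
    then obtain u v where uv: "h ?e0 = F u v" "h ?e1 = G u v" using ex by blast
    show "f h \<in> mcarrier (tri p' c' q')" using f[OF uv] by simp
    have "f (msmul ?H r h) = cl p' c' q' (r * u) (r * v)"
      by (rule f) (simp_all add: hom_mod_def e uv F_smul G_smul)
    then show "f (msmul ?H r h) = msmul (tri p' c' q') r (f h)" using f[OF uv] by simp
    assume k: "k \<in> mcarrier ?H"
    then obtain u' v' where uv': "k ?e0 = F u' v'" "k ?e1 = G u' v'" using ex by blast
    have "f (madd ?H h k) = cl p' c' q' (u + u') (v + v')"
      by (rule f) (simp_all add: hom_mod_def e uv uv' F_add G_add)
    then show "f (madd ?H h k) = madd (tri p' c' q') (f h) (f k)" using f[OF uv] f[OF uv'] by simp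
  qed
  have "h = k" if h: "h \<in> mcarrier ?H" and k: "k \<in> mcarrier ?H" and fe: "f h = f k" for h k
  proof -
    obtain u v where uv: "h ?e0 = F u v" "h ?e1 = G u v" using ex[OF h] by blast
    obtain u' v' where uv': "k ?e0 = F u' v'" "k ?e1 = G u' v'" using ex[OF k] by blast
    have "F u v = F u' v' \<and> G u v = G u' v'" unfolding eq using fe f[OF uv] f[OF uv'] by simp
    then have gens: "h ?e0 = k ?e0" "h ?e1 = k ?e1" using uv uv' by simp_all
    have "h X = k X" if X: "X \<in> mcarrier (tri p c q)" for X
    proof -
      obtain u v where "X = cl p c q u v" using X by (auto simp: tri_carrier)
      then show ?thesis
        using mlinear_tri(2)[OF H[OF h], of u v] mlinear_tri(2)[OF H[OF k], of u v] gens by simp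
    qed
    moreover have "h X = k X" if "X \<notin> mcarrier (tri p c q)" for X
      using that h k by (simp add: hom_mod_def)
    ultimately show ?thesis by blast
  qed
  then have "inj_on f (mcarrier ?H)" by (rule inj_onI)
  moreover have "cl p' c' q' u v \<in> f ` mcarrier ?H" for u v
  proof -
    let ?h = "gen_hom p c q N (F u v) (G u v)"
    have "?h ?e0 = F u v" "?h ?e1 = G u v"
      using gen_hom_cl[OF rel] FG
      by (simp_all add: one_smul zero_smul add_zero add_comm[OF zero_closed])
    then have "f ?h = cl p' c' q' u v" by (rule f)
    then show ?thesis using gen_hom_closed[OF rel] by force
  qed
  ultimately have "bij_betw f (mcarrier ?H) (mcarrier (tri p' c' q'))"
    using mlinear_closed[OF lin] unfolding bij_betw_def by (auto simp: tri_carrier)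
  then show ?thesis using lin unfolding miso_def by blast
qed

lemma exI2: "P a b \<Longrightarrow> \<exists>s t. P s t"
  by blast

text \<open>Replacing \<open>v\<close> by \<open>- v\<close> in the parametrisation flips the sign
  of the corner, so one parametrisation serves both signs.\<close>

lemma miso_hom_tri_minus:
  assumes N: "amodule N"
    and rel: "\<And>u v. tri_rel p c q N (F u v) (G u v)"
    and F_add: "\<And>u v u' v'. F (u + u') (v + v') = madd N (F u v) (F u' v')"
    and G_add: "\<And>u v u' v'. G (u + u') (v + v') = madd N (G u v) (G u' v')"
    and F_smul: "\<And>r u v. F (r * u) (r * v) = msmul N r (F u v)"
    and G_smul: "\<And>r u v. G (r * u) (r * v) = msmul N r (G u v)"
    and surj: "\<And>n0 n1. tri_rel p c q N n0 n1 \<Longrightarrow> \<exists>u v. n0 = F u v \<and> n1 = G u v"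
    and kernel: "\<And>u v. F u v = mzero N \<and> G u v = mzero N \<longleftrightarrow> (\<exists>s t. u = p' * s + c' * t \<and> v = q' * t)"
  shows "miso (hom_mod (tri p c q) N) (tri p' c' q')"
    and "miso (hom_mod (tri p c q) N) (tri p' (- c') q')"
proof -
  show "miso (hom_mod (tri p c q) N) (tri p' c' q')"
    using assms by (rule miso_hom_tri)
  show "miso (hom_mod (tri p c q) N) (tri p' (- c') q')"
  proof (rule miso_hom_tri[where F = "\<lambda>u v. F u (- v)" and G = "\<lambda>u v. G u (- v)", OF N])
    show "\<exists>u v. n0 = F u (- v) \<and> n1 = G u (- v)" if "tri_rel p c q N n0 n1" for n0 n1
      using surj[OF that] by (metis minus_minus)
    fix u v
    have "(\<exists>s t. u = p' * s + c' * t \<and> - v = q' * t) \<longleftrightarrow> (\<exists>s t. u = p' * s + - c' * t \<and> v = q' * t)"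
      by (metis minus_minus mult_minus_left mult_minus_right)
    then show "F u (- v) = mzero N \<and> G u (- v) = mzero N \<longleftrightarrow> (\<exists>s t. u = p' * s + - c' * t \<and> v = q' * t)"
      using kernel by simp
    fix r u' v'
    show "F (u + u') (- (v + v')) = madd N (F u (- v)) (F u' (- v'))"
      "G (u + u') (- (v + v')) = madd N (G u (- v)) (G u' (- v'))"
      using F_add[of u u' "- v" "- v'"] G_add[of u u' "- v" "- v'"] by simp_all
    show "F (r * u) (- (r * v)) = msmul N r (F u (- v))" "G (r * u) (- (r * v)) = msmul N r (G u (- v))"
      using F_smul[of r u "- v"] G_smul[of r u "- v"] by simp_all
  qed (rule rel)
qed

section \<open>Explicit Hom modules for a regular exact pair\<close>

locale regular_pair =
  fixes x y :: "'a::comm_ring_1"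
  assumes pair: "regular_exact_pair x y"
begin

lemma xy: "x * y = 0" "y * x = 0"
proof -
  have "y \<in> ann x" using pair
    by (auto simp: regular_exact_pair_def exact_pair_def mem_pideal)
  then show "x * y = 0" "y * x = 0" by (simp_all add: ann_def mult.commute)
qed

lemma xy_left: "x * (y * r) = 0" "y * (x * r) = 0"
  using xy by (simp_all flip: mult.assoc)

lemma ann_x: "x * r = 0 \<Longrightarrow> \<exists>s. r = y * s"
proof -
  assume "x * r = 0"
  then have "r \<in> ann x" by (simp add: ann_def mult.commute)
  then show ?thesis using pair by (auto simp: regular_exact_pair_def exact_pair_def pideal_def)
qed

lemma ann_y: "y * r = 0 \<Longrightarrow> \<exists>s. r = x * s"
proof -
  assume "y * r = 0"
  then have "r \<in> ann y" by (simp add: ann_def mult.commute)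
  then show ?thesis using pair by (auto simp: regular_exact_pair_def exact_pair_def pideal_def)
qed

lemma int_zero: assumes "x * r = y * s" shows "x * r = 0" "y * s = 0"
proof -
  have "x * r \<in> pideal x \<inter> pideal y" using assms by (metis Int_iff mem_pideal dvd_triv_left)
  then show "x * r = 0" "y * s = 0" using pair assms by (auto simp: regular_exact_pair_def)
qed

lemma swap: "regular_pair y x"
  using pair unfolding regular_pair_def regular_exact_pair_def exact_pair_def by auto

lemma tri_rel_cl:
  "tri_rel p a q (tri x c y) (cl x c y u v) (cl x c y u' v') \<longleftrightarrow>
    (\<exists>s t. p * u = x * s + c * t \<and> p * v = y * t) \<and>
    (\<exists>s t. a * u + q * u' = x * s + c * t \<and> a * v + q * v' = y * t)"
  by (simp add: tri_rel_def cl_eq_iff)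

lemma tri_rel_tri_obtain:
  assumes "tri_rel p a q (tri x c y) n0 n1"
  obtains u v u' v' where "n0 = cl x c y u v" "n1 = cl x c y u' v'"
  using assms unfolding tri_rel_def tri_carrier by blast

text \<open>The equations are \<open>y n0 = 0\<close> and \<open>a n0 + x n1 = 0\<close>. The first,
  with \<open>c\<close> regular, leaves for \<open>n0\<close> only multiples of \<open>x\<close>
  times the second generator; the second then fixes the second coordinate of \<open>n1\<close> and
  leaves the first one free.\<close>

lemma hom_opposite_rel:
  assumes c: "regular_mod x y c" and rel: "tri_rel y a x (tri x c y) n0 n1"
  shows "\<exists>u v. n0 = cl x c y 0 (- (x * v)) \<and> n1 = cl x c y u (a * v)"
proof -
  obtain u v u1 v1 where n: "n0 = cl x c y u v" "n1 = cl x c y u1 v1"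
    using rel by (rule tri_rel_tri_obtain)
  obtain s t where 1: "y * u = x * s + c * t" "y * v = y * t" using rel unfolding n tri_rel_cl by blast
  have "y * (v - t) = 0" using 1 by (simp add: right_diff_distrib)
  then obtain w where w: "v - t = x * w" using ann_y by blast
  \<comment> \<open>The right-hand side vanishes by the equations found so far, so this exhibits
    \<open>c * v\<close> as an element of the ideal (x,y), ready for the regularity of
    \<open>c\<close>.\<close>
  have "c * v - (x * (c * w - s) + y * u) = c * (v - t - x * w) - (y * u - (x * s + c * t))"
    by (simp add: algebra_simps)
  then have "c * v = x * (c * w - s) + y * u" using w 1 by simp
  then obtain \<alpha> \<beta> where v: "v = x * \<alpha> + y * \<beta>" using c unfolding regular_mod_def by blast
  \<comment> \<open>Substituting \<open>v\<close> back leaves a multiple of \<open>x\<close> equal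
    to a multiple of \<open>y\<close>; both vanish because the two ideals meet in zero.\<close>
  have "x * (s - c * w + c * \<alpha>) - y * (u - c * \<beta>)
      = - (y * u - (x * s + c * t)) + c * (v - t - x * w) - c * (v - (x * \<alpha> + y * \<beta>))"
    by (simp add: algebra_simps)
  then have "x * (s - c * w + c * \<alpha>) = y * (u - c * \<beta>)" using w 1 v by simp
  then obtain \<delta> where \<delta>: "u - c * \<beta> = x * \<delta>" using int_zero ann_y by blast
  \<comment> \<open>Subtract \<open>\<delta>\<close> times the first column \<open>(x, 0)\<close>
    and \<open>\<beta>\<close> times the second column \<open>(c, y)\<close>.\<close>
  have n0: "n0 = cl x c y 0 (x * \<alpha>)"
    unfolding n cl_eq_iff using \<delta> v by (intro exI2[of _ \<delta> \<beta>]) (simp add: algebra_simps)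
  obtain s t where 2: "x * u1 = x * s + c * t" "a * (x * \<alpha>) + x * v1 = y * t"
    using rel unfolding n(2) n0 tri_rel_cl by auto
  have "x * (a * \<alpha> + v1) = y * t" using 2 by (simp add: algebra_simps)
  then obtain \<beta>' where "a * \<alpha> + v1 = y * \<beta>'" using int_zero ann_x by blast
  then have "n1 = cl x c y (u1 - c * \<beta>') (a * (- \<alpha>))"
    unfolding n cl_eq_iff by (intro exI2[of _ 0 \<beta>']) (simp add: algebra_simps)
  then show ?thesis using n0 by (intro exI2[of _ "u1 - c * \<beta>'" "- \<alpha>"]) (simp add: algebra_simps)
qed

text \<open>This is where the corners multiply: with \<open>v = y * t\<close> the second coordinate
  of \<open>n1\<close> is \<open>y * (a * t)\<close>, and removing it by the column
  \<open>(c, y)\<close> costs \<open>c * a * t\<close> in the first coordinate.\<close>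

lemma miso_hom_opposite:
  assumes c: "regular_mod x y c"
  shows "miso (hom_mod (tri y a x) (tri x c y)) (tri x (a * c) y)"
    and "miso (hom_mod (tri y a x) (tri x c y)) (tri x (- (a * c)) y)"
proof -
  let ?F = "\<lambda>u v. cl x c y 0 (- (x * v))" and ?G = "\<lambda>u v. cl x c y u (a * v)" and ?N = "tri x c y"
  have rel: "tri_rel y a x ?N (?F u v) (?G u v)" for u v
    unfolding tri_rel_cl
  proof
    show "\<exists>s t. y * 0 = x * s + c * t \<and> y * - (x * v) = y * t"
      by (intro exI2[of _ 0 0]) (simp add: xy_left)
    show "\<exists>s t. a * 0 + x * u = x * s + c * t \<and> a * - (x * v) + x * (a * v) = y * t"
      by (intro exI2[of _ u 0]) (simp add: algebra_simps)
  qed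
  have kernel: "?F u v = mzero ?N \<and> ?G u v = mzero ?N \<longleftrightarrow> (\<exists>s t. u = x * s + a * c * t \<and> v = y * t)"
    (is "?L \<longleftrightarrow> ?R") for u v
  proof
    assume ?L
    then obtain s t s' t' where 1: "- (x * v) = y * t" and 2: "u = x * s' + c * t'" "a * v = y * t'"
      unfolding tri_zero cl_eq_zero_iff by blast
    have "x * (- v) = y * t" using 1 by simp
    then have "x * (- v) = 0" by (rule int_zero)
    then obtain \<gamma> where \<gamma>: "v = y * \<gamma>" using ann_x[of v] by auto
    \<comment> \<open>\<open>v\<close> determines \<open>t'\<close> only up to a multiple of
      \<open>x\<close>, and that ambiguity is absorbed by the column \<open>(x, 0)\<close>.\<close>
    have "y * (a * \<gamma> - t') = 0" using \<gamma> 2 by (simp add: algebra_simps)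
    then obtain w where "a * \<gamma> - t' = x * w" using ann_y by blast
    then have t': "t' = a * \<gamma> - x * w" by (simp add: algebra_simps)
    show ?R using \<gamma> unfolding 2 t'
      by (intro exI2[of _ "s' - c * w" \<gamma>]) (simp add: algebra_simps)
  next
    assume ?R
    then obtain s t where "u = x * s + a * c * t" "v = y * t" by blast
    then show ?L unfolding tri_zero cl_eq_zero_iff
      by (intro conjI exI[of _ s] exI[of _ "a * t"] exI[of _ 0]) (simp_all add: xy xy_left algebra_simps)
  qed
  show "miso (hom_mod (tri y a x) ?N) (tri x (a * c) y)"
    by (rule miso_hom_tri_minus(1)[where F = ?F and G = ?G, OF amodule_tri rel _ _ _ _ hom_opposite_rel[OF c] kernel])
       (simp_all add: algebra_simps)
  show "miso (hom_mod (tri y a x) ?N) (tri x (- (a * c)) y)"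
    by (rule miso_hom_tri_minus(2)[where F = ?F and G = ?G, OF amodule_tri rel _ _ _ _ hom_opposite_rel[OF c] kernel])
       (simp_all add: algebra_simps)
qed

text \<open>If \<open>x\<close> kills the class of \<open>(u, v)\<close>, then \<open>x * v\<close>
  is a multiple of \<open>y\<close>, hence zero, so \<open>v\<close> is a multiple of
  \<open>y\<close> and the column \<open>(c, y)\<close> removes it.\<close>

lemma ann_x_tri:
  assumes "tri_rel x a y (tri x c y) n0 n1"
  obtains k where "n0 = cl x c y k 0"
proof -
  obtain u v u1 v1 where n: "n0 = cl x c y u v" "n1 = cl x c y u1 v1"
    using assms by (rule tri_rel_tri_obtain)
  obtain t where "x * v = y * t" using assms unfolding n tri_rel_cl by blast
  then obtain \<beta> where "v = y * \<beta>" using int_zero ann_x by blast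
  then have "n0 = cl x c y (u - c * \<beta>) 0"
    unfolding n cl_eq_iff by (intro exI2[of _ 0 \<beta>]) simp
  then show thesis by (rule that)
qed

text \<open>Two homomorphisms generate: \<open>v = 1\<close> fixes the second generator and
  multiplies the first by \<open>e\<close>; \<open>u = 1\<close> multiplies the first by
  \<open>y\<close> and sends the second to \<open>- a\<close> times the first.\<close>

lemma hom_up_rel:
  assumes a: "regular_mod x y a" and rel: "tri_rel x a y (tri x (a * e) y) n0 n1"
  shows "\<exists>u v. n0 = cl x (a * e) y (e * v + y * u) 0 \<and> n1 = cl x (a * e) y (- (a * u)) v"
proof -
  let ?c = "a * e"
  obtain k where k: "n0 = cl x ?c y k 0" using rel by (rule ann_x_tri)
  obtain P R where n1: "n1 = cl x ?c y P R" using rel by (metis tri_rel_tri_obtain)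
  obtain s t where 1: "a * k + y * P = x * s + ?c * t" "y * R = y * t"
    using rel unfolding k n1 tri_rel_cl by auto
  have "y * (R - t) = 0" using 1 by (simp add: right_diff_distrib)
  then obtain w where w: "R - t = x * w" using ann_y by blast
  \<comment> \<open>The corner of the target is a multiple of \<open>a\<close>, so \<open>a\<close>
    can be factored out and its regularity applied to \<open>k - e * R\<close>.\<close>
  have "a * (k - e * R) - (x * (s - ?c * w) + y * (- P))
      = (a * k + y * P - (x * s + ?c * t)) - ?c * (R - t - x * w)" by (simp add: algebra_simps)
  then have "a * (k - e * R) = x * (s - ?c * w) + y * (- P)" using w 1 by simp
  then obtain \<alpha> \<sigma> where \<sigma>: "k - e * R = x * \<alpha> + y * \<sigma>" using a unfolding regular_mod_def by blast
  have n0: "n0 = cl x ?c y (e * R + y * \<sigma>) 0"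
    unfolding k cl_eq_iff using \<sigma> by (intro exI2[of _ \<alpha> 0]) (simp add: algebra_simps)
  have "x * (s - ?c * w - a * \<alpha>) - y * (a * \<sigma> + P)
      = - (a * k + y * P - (x * s + ?c * t)) + ?c * (R - t - x * w) + a * (k - e * R - (x * \<alpha> + y * \<sigma>))"
    by (simp add: algebra_simps)
  then have "x * (s - ?c * w - a * \<alpha>) = y * (a * \<sigma> + P)" using w 1 \<sigma> by simp
  then obtain \<omega> where "a * \<sigma> + P = x * \<omega>" using int_zero ann_y by blast
  then have "n1 = cl x ?c y (- (a * \<sigma>)) R"
    unfolding n1 cl_eq_iff by (intro exI2[of _ \<omega> 0]) (simp add: algebra_simps)
  then show ?thesis using n0 by blast
qed

lemma miso_hom_up:
  assumes a: "regular_mod x y a"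
  shows "miso (hom_mod (tri x a y) (tri x (a * e) y)) (tri x e y)"
    and "miso (hom_mod (tri x a y) (tri x (a * e) y)) (tri x (- e) y)"
proof -
  let ?c = "a * e"
  let ?F = "\<lambda>u v. cl x ?c y (e * v + y * u) 0" and ?G = "\<lambda>u v. cl x ?c y (- (a * u)) v" and ?N = "tri x ?c y"
  have rel: "tri_rel x a y ?N (?F u v) (?G u v)" for u v
    unfolding tri_rel_cl
  proof
    show "\<exists>s t. x * (e * v + y * u) = x * s + ?c * t \<and> x * 0 = y * t"
      by (intro exI2[of _ "e * v" 0]) (simp add: xy xy_left algebra_simps)
    show "\<exists>s t. a * (e * v + y * u) + y * - (a * u) = x * s + ?c * t \<and> a * 0 + y * v = y * t"
      by (intro exI2[of _ 0 v]) (simp add: algebra_simps)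
  qed
  have kernel: "?F u v = mzero ?N \<and> ?G u v = mzero ?N \<longleftrightarrow> (\<exists>s t. u = x * s + - e * t \<and> v = y * t)"
    (is "?L \<longleftrightarrow> ?R") for u v
  proof
    assume ?L
    then obtain s t s' t' where 1: "e * v + y * u = x * s + ?c * t" "0 = y * t" and 2: "v = y * t'"
      unfolding tri_zero cl_eq_zero_iff by blast
    obtain w where w: "t = x * w" using 1(2) ann_y[of t] by auto
    have "x * (s + ?c * w) - y * (e * t' + u)
        = - (e * v + y * u - (x * s + ?c * t)) - ?c * (t - x * w) + e * (v - y * t')"
      by (simp add: algebra_simps)
    then have "x * (s + ?c * w) = y * (e * t' + u)" using 1(1) 2 w by simp
    then obtain \<delta> where "e * t' + u = x * \<delta>" using int_zero ann_y by blast
    then show ?R using 2 by (intro exI2[of _ \<delta> t']) (simp add: algebra_simps)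
  next
    assume ?R
    then obtain s t where u: "u = x * s + - e * t" and v: "v = y * t" by blast
    have "e * v + y * u = x * 0 + ?c * 0 \<and> 0 = y * 0" by (simp add: u v xy xy_left algebra_simps)
    moreover have "- (a * u) = x * (- (a * s)) + ?c * t \<and> v = y * t" by (simp add: u v algebra_simps)
    ultimately show ?L unfolding tri_zero cl_eq_zero_iff by blast
  qed
  show "miso (hom_mod (tri x a y) ?N) (tri x (- e) y)"
    by (rule miso_hom_tri_minus(1)[where F = ?F and G = ?G, OF amodule_tri rel _ _ _ _ hom_up_rel[OF a] kernel])
       (simp_all add: algebra_simps)
  \<comment> \<open>The kernel of the parametrisation has corner \<open>- e\<close>; the variant
    with the other sign yields \<open>e\<close>.\<close>
  have "miso (hom_mod (tri x a y) ?N) (tri x (- (- e)) y)"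
    by (rule miso_hom_tri_minus(2)[where F = ?F and G = ?G, OF amodule_tri rel _ _ _ _ hom_up_rel[OF a] kernel])
       (simp_all add: algebra_simps)
  then show "miso (hom_mod (tri x a y) ?N) (tri x e y)" by simp
qed

text \<open>Two homomorphisms generate: \<open>v = 1\<close> fixes the first generator and
  multiplies the second by \<open>e\<close>; \<open>u = 1\<close> kills the first and multiplies the
  second by \<open>x\<close>.\<close>

lemma hom_down_rel:
  assumes c: "regular_mod x y c" and rel: "tri_rel x (c * e) y (tri x c y) n0 n1"
  shows "\<exists>u v. n0 = cl x c y v 0 \<and> n1 = cl x c y 0 (e * v + x * u)"
proof -
  obtain k where k: "n0 = cl x c y k 0" using rel by (rule ann_x_tri)
  obtain P R where n1: "n1 = cl x c y P R" using rel by (metis tri_rel_tri_obtain)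
  obtain s t where 1: "c * e * k + y * P = x * s + c * t" "y * R = y * t"
    using rel unfolding k n1 tri_rel_cl by auto
  have "y * (R - t) = 0" using 1 by (simp add: right_diff_distrib)
  then obtain w where w: "R - t = x * w" using ann_y by blast
  have "c * (e * k - R) - (x * (s - c * w) + y * (- P))
      = (c * e * k + y * P - (x * s + c * t)) - c * (R - t - x * w)" by (simp add: algebra_simps)
  then have "c * (e * k - R) = x * (s - c * w) + y * (- P)" using w 1 by simp
  then obtain \<alpha> \<sigma> where \<sigma>: "e * k - R = x * \<alpha> + y * \<sigma>" using c unfolding regular_mod_def by blast
  have "x * (s - c * w - c * \<alpha>) - y * (P + c * \<sigma>)
      = - (c * e * k + y * P - (x * s + c * t)) + c * (R - t - x * w) + c * (e * k - R - (x * \<alpha> + y * \<sigma>))"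
    by (simp add: algebra_simps)
  then have "x * (s - c * w - c * \<alpha>) = y * (P + c * \<sigma>)" using w 1 \<sigma> by simp
  then obtain \<omega> where "P + c * \<sigma> = x * \<omega>" using int_zero ann_y by blast
  then have "n1 = cl x c y 0 (e * k + x * (- \<alpha>))"
    unfolding n1 cl_eq_iff using \<sigma> by (intro exI2[of _ \<omega> "- \<sigma>"]) (simp add: algebra_simps)
  then show ?thesis using k by blast
qed

text \<open>Here \<open>x\<close> and \<open>y\<close> change places: the first generator is killed
  by \<open>x\<close>, and the homomorphism with \<open>u = 1\<close> takes values in
  \<open>x\<close> times the second generator, so it is killed by \<open>y\<close>. Hence the answer
  is of type \<open>H\<close>.\<close>

lemma miso_hom_down:
  assumes c: "regular_mod x y c"
  shows "miso (hom_mod (tri x (c * e) y) (tri x c y)) (tri y e x)"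
    and "miso (hom_mod (tri x (c * e) y) (tri x c y)) (tri y (- e) x)"
proof -
  let ?F = "\<lambda>u v. cl x c y v 0" and ?G = "\<lambda>u v. cl x c y 0 (e * v + x * u)" and ?N = "tri x c y"
  have rel: "tri_rel x (c * e) y ?N (?F u v) (?G u v)" for u v
    unfolding tri_rel_cl
  proof
    show "\<exists>s t. x * v = x * s + c * t \<and> x * 0 = y * t"
      by (intro exI2[of _ v 0]) simp
    show "\<exists>s t. c * e * v + y * 0 = x * s + c * t \<and> c * e * 0 + y * (e * v + x * u) = y * t"
      by (intro exI2[of _ 0 "e * v"]) (simp add: xy xy_left algebra_simps)
  qed
  have kernel: "?F u v = mzero ?N \<and> ?G u v = mzero ?N \<longleftrightarrow> (\<exists>s t. u = y * s + - e * t \<and> v = x * t)"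
    (is "?L \<longleftrightarrow> ?R") for u v
  proof
    assume ?L
    then obtain s t t' where 1: "v = x * s + c * t" "0 = y * t" and 2: "e * v + x * u = y * t'"
      unfolding tri_zero cl_eq_zero_iff by blast
    obtain w where w: "t = x * w" using 1(2) ann_y[of t] by auto
    define \<delta> where "\<delta> = s + c * w"
    have v: "v = x * \<delta>" unfolding \<delta>_def using 1(1) w by (simp add: algebra_simps)
    have "x * (e * \<delta> + u) = y * t'" using 2 v by (simp add: algebra_simps)
    then obtain \<gamma> where "e * \<delta> + u = y * \<gamma>" using int_zero ann_x by blast
    then show ?R using v by (intro exI2[of _ \<gamma> \<delta>]) (simp add: algebra_simps)
  next
    assume ?R
    then obtain s t where u: "u = y * s + - e * t" and v: "v = x * t" by blast
    have "v = x * t + c * 0 \<and> 0 = y * 0" by (simp add: v)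
    moreover have "0 = x * 0 + c * 0 \<and> e * v + x * u = y * 0" by (simp add: u v xy xy_left algebra_simps)
    ultimately show ?L unfolding tri_zero cl_eq_zero_iff by blast
  qed
  show "miso (hom_mod (tri x (c * e) y) ?N) (tri y (- e) x)"
    by (rule miso_hom_tri_minus(1)[where F = ?F and G = ?G, OF amodule_tri rel _ _ _ _ hom_down_rel[OF c] kernel])
       (simp_all add: algebra_simps)
  have "miso (hom_mod (tri x (c * e) y) ?N) (tri y (- (- e)) x)"
    by (rule miso_hom_tri_minus(2)[where F = ?F and G = ?G, OF amodule_tri rel _ _ _ _ hom_down_rel[OF c] kernel])
       (simp_all add: algebra_simps)
  then show "miso (hom_mod (tri x (c * e) y) ?N) (tri y e x)" by simp
qed

end

subsection \<open>Freeness, indecomposability and non-isomorphism\<close>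

lemma ex1_imp_eq: "\<exists>!c. P c \<Longrightarrow> P a \<Longrightarrow> P b \<Longrightarrow> a = b"
  by blast

section \<open>Finite sums and annihilators in free modules\<close>

context amodule
begin

lemma msum_empty: "msum M f {} = mzero M"
  by (simp add: msum_def)

lemma msum_insert_closed:
  assumes S: "finite S" "b \<notin> S" and f: "\<And>c. c \<in> insert b S \<Longrightarrow> f c \<in> mcarrier M"
  shows "msum M f (insert b S) = madd M (f b) (msum M f S) \<and> msum M f S \<in> mcarrier M"
proof -
  \<comment> \<open>The laws of \<open>Finite_Set.fold\<close> ask for commutation everywhere, but
    \<open>madd M\<close> commutes only on the carrier. \<open>g\<close> does nothing elsewhere and
    gives the same fold.\<close>
  define g where "g c u = (if u \<in> mcarrier M \<and> f c \<in> mcarrier M then madd M (f c) u else u)" for c u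
  interpret comp_fun_commute g
    by unfold_locales (auto simp: g_def fun_eq_iff add_closed add_left_commute)
  have eq: "msum M f T = Finite_Set.fold g (mzero M) T" if "T \<subseteq> insert b S" for T
    unfolding msum_def
    by (rule fold_closed_eq[where B = "mcarrier M"]) (use that f in \<open>auto simp: g_def add_closed zero_closed\<close>)
  have g_closed: "g c u \<in> mcarrier M" if "u \<in> mcarrier M" for c u
    using that by (simp add: g_def add_closed)
  have "Finite_Set.fold g (mzero M) S \<in> mcarrier M"
    using S(1) by induction (simp_all add: zero_closed g_closed)
  then show ?thesis
    using S f eq[of S] eq[of "insert b S"] by (simp add: g_def subset_insertI)
qed

lemmas msum_insert = msum_insert_closed[THEN conjunct1]

lemma msum_closed:
  assumes "finite S" and "\<And>c. c \<in> S \<Longrightarrow> f c \<in> mcarrier M"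
  shows "msum M f S \<in> mcarrier M"
  using assms
proof (induction S)
  case empty
  then show ?case by (simp add: msum_empty zero_closed)
next
  case (insert b S)
  then have "msum M f (insert b S) = madd M (f b) (msum M f S)" by (intro msum_insert) auto
  then show ?case using insert by (simp add: add_closed)
qed

lemma msum_smul:
  assumes "finite S" and "S \<subseteq> mcarrier M"
  shows "msum M (\<lambda>e. msmul M (r * c e) e) S = msmul M r (msum M (\<lambda>e. msmul M (c e) e) S)"
  using assms
proof (induction S)
  case empty
  then show ?case by (simp add: msum_empty smul_zero)
next
  case (insert b S)
  then have M: "msmul M s e \<in> mcarrier M" if "e \<in> insert b S" for s e
    using that by (auto simp: smul_closed)
  have "msum M (\<lambda>e. msmul M (c e) e) S \<in> mcarrier M"
    using insert M by (intro msum_closed) auto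
  moreover have "msum M (\<lambda>e. msmul M (d e) e) (insert b S)
      = madd M (msmul M (d b) b) (msum M (\<lambda>e. msmul M (d e) e) S)" for d
    using insert.hyps M by (intro msum_insert) auto
  ultimately show ?case using insert M by (simp add: smul_add smul_smul)
qed

text \<open>\<open>mfree\<close> sums over the exact support of the coefficients, and multiplying
  them by a zero divisor can shrink the support.\<close>

lemma msum_mono_neutral:
  assumes "finite S" "T \<subseteq> S" and "\<And>b. b \<in> S \<Longrightarrow> f b \<in> mcarrier M" and "\<And>b. b \<in> S - T \<Longrightarrow> f b = mzero M"
  shows "msum M f T = msum M f S"
  using assms
proof (induction S arbitrary: T)
  case empty
  then show ?case by simp
next
  case (insert b S)
  have step: "msum M f (insert b S) = madd M (f b) (msum M f S)"
    using insert.hyps insert.prems by (intro msum_insert) auto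
  have zero: "madd M (mzero M) u = u" if "u \<in> mcarrier M" for u
    using that by (simp add: add_comm[OF zero_closed] add_zero)
  show ?case
  proof (cases "b \<in> T")
    case True
    have "msum M f (T - {b}) = msum M f S"
      using insert.hyps insert.prems by (intro insert.IH) auto
    moreover have "finite (T - {b})" using insert.hyps insert.prems(1) by (meson finite_Diff finite_insert finite_subset)
    then have "msum M f (insert b (T - {b})) = madd M (f b) (msum M f (T - {b}))"
      using insert.prems by (intro msum_insert) auto
    ultimately show ?thesis using True insert.hyps insert.prems by (simp add: insert_absorb step)
  next
    case False
    then have "msum M f T = msum M f S"
      using insert.prems by (intro insert.IH) auto
    moreover have "msum M f S \<in> mcarrier M"
      using insert.hyps insert.prems(2) by (intro msum_closed) auto
    moreover have "f b = mzero M" using False insert.prems(3)[of b] by blast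
    ultimately show ?thesis by (simp only: step zero)
  qed
qed

text \<open>If \<open>x\<close> kills \<open>u\<close>, uniqueness of coordinates shows that
  \<open>x\<close> kills each coordinate of \<open>u\<close>; by \<open>ann\<close> each coordinate
  is then a multiple of \<open>y\<close>.\<close>

lemma mfree_annihilator:
  assumes free: "mfree M" and u: "u \<in> mcarrier M" "msmul M x u = mzero M"
    and ann: "\<And>r. x * r = 0 \<Longrightarrow> \<exists>s. r = y * s"
  shows "\<exists>w\<in>mcarrier M. u = msmul M y w"
proof -
  let ?sum = "\<lambda>c. msum M (\<lambda>e. msmul M (c e) e)"
  obtain B where B: "B \<subseteq> mcarrier M" and all: "\<forall>u\<in>mcarrier M.
      \<exists>!c. (\<forall>e. e \<notin> B \<longrightarrow> c e = 0) \<and> finite {e. c e \<noteq> 0} \<and> u = ?sum c {e. c e \<noteq> 0}"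
    using free unfolding mfree_def by (elim exE conjE that)
  note uniq = bspec[OF all]
  obtain c where c: "\<forall>e. e \<notin> B \<longrightarrow> c e = 0" "finite {e. c e \<noteq> 0}"
    and uc: "u = ?sum c {e. c e \<noteq> 0}"
    using ex1_implies_ex[OF uniq[OF u(1)]] by (elim exE conjE that)
  have S: "{e. c e \<noteq> 0} \<subseteq> mcarrier M" using c(1) B by blast
  have closed: "msmul M r e \<in> mcarrier M" if "e \<in> {e. c e \<noteq> 0}" for r e
    using that S smul_closed by blast
  have "mzero M = ?sum (\<lambda>e. x * c e) {e. c e \<noteq> 0}"
    using u(2) unfolding uc msum_smul[OF c(2) S] by simp
  also have "\<dots> = ?sum (\<lambda>e. x * c e) {e. x * c e \<noteq> 0}"
    by (rule msum_mono_neutral[symmetric, OF c(2)]) (use closed S zero_smul in auto)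
  finally have "mzero M = ?sum (\<lambda>e. x * c e) {e. x * c e \<noteq> 0}" .
  moreover have "finite {e. x * c e \<noteq> 0}" by (rule finite_subset[OF _ c(2)]) auto
  moreover have "mzero M = ?sum (\<lambda>e. 0) {e. (0::'a) \<noteq> 0}" by (simp add: msum_empty)
  \<comment> \<open>Both coefficient families represent zero, so uniqueness makes them
    equal.\<close>
  ultimately have "(\<lambda>e. x * c e) = (\<lambda>e. 0)"
    using c(1) by (intro ex1_imp_eq[OF uniq[OF zero_closed]]) simp_all
  then have "\<exists>s. c e = y * s" for e using ann by meson
  then obtain d where d: "\<And>e. c e = y * d e" by metis
  \<comment> \<open>\<open>d\<close> may be non-zero outside the support of \<open>c\<close>, so the
    sum stays indexed by that finite set.\<close>
  have "u = msmul M y (?sum d {e. c e \<noteq> 0})"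
    using uc unfolding msum_smul[OF c(2) S, symmetric] d[symmetric] .
  moreover have "?sum d {e. c e \<noteq> 0} \<in> mcarrier M" using closed by (intro msum_closed c(2))
  ultimately show ?thesis by blast
qed

end

lemma miso_sym:
  assumes M: "amodule M" and "miso M N"
  shows "miso N M"
proof -
  interpret amodule M by (rule M)
  obtain f where f: "mlinear f M N" and bij: "bij_betw f (mcarrier M) (mcarrier N)"
    using assms(2) by (auto simp: miso_def)
  let ?g = "inv_into (mcarrier M) f"
  have g: "?g u \<in> mcarrier M" "f (?g u) = u" if "u \<in> mcarrier N" for u
    using that bij by (auto simp: bij_betw_def inv_into_into f_inv_into_f)
  have gf: "?g u = v" if "v \<in> mcarrier M" "f v = u" for u v
    using that bij by (auto simp: bij_betw_def)
  have "mlinear ?g N M"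
    unfolding mlinear_def
  proof (intro conjI ballI allI)
    fix u v r assume u: "u \<in> mcarrier N"
    show "?g u \<in> mcarrier M" by (rule g(1)[OF u])
    show "?g (msmul N r u) = msmul M r (?g u)"
      using f g u by (intro gf) (auto simp: smul_closed mlinear_def)
    assume v: "v \<in> mcarrier N"
    show "?g (madd N u v) = madd M (?g u) (?g v)"
      using f g u v by (intro gf) (auto simp: add_closed mlinear_def)
  qed
  then show ?thesis using bij_betw_inv_into[OF bij] by (auto simp: miso_def)
qed

section \<open>Consequences of locality\<close>

locale local_regular_pair = regular_pair x y for x y :: "'a::comm_ring_1" +
  fixes m :: "'a set"
  assumes ideal: "ring_ideal m" and mem_m: "r \<in> m \<longleftrightarrow> \<not> r dvd 1"
begin

lemma m_add: "r \<in> m \<Longrightarrow> s \<in> m \<Longrightarrow> r + s \<in> m"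
  and m_mult: "r \<in> m \<Longrightarrow> s * r \<in> m" "r \<in> m \<Longrightarrow> r * s \<in> m"
  using ideal unfolding ring_ideal_def by (auto simp: mult.commute[of _ s])

lemma m_minus: "r \<in> m \<Longrightarrow> - r \<in> m"
  using m_mult(1)[of r "-1"] by simp

lemma one_notin_m: "1 \<notin> m"
  by (simp add: mem_m)

lemma xy_m: "x \<in> m" "y \<in> m"
  using pair by (auto simp: mem_m regular_exact_pair_def exact_pair_def)

lemma unit_cases:
  fixes k :: 'a
  obtains s where "k * s = 1" | s where "(1 - k) * s = 1"
proof -
  have "k \<notin> m \<or> 1 - k \<notin> m" using m_add[of k "1 - k"] one_notin_m by auto
  then show thesis using that unfolding mem_m dvd_def by auto
qed

lemma local_swap: "local_regular_pair y x m"
  using swap ideal mem_m by (simp add: local_regular_pair_def local_regular_pair_axioms_def)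

text \<open>All entries of the matrix lie in \<open>m\<close>, so the coordinates of a class are
  well defined modulo \<open>m\<close>.\<close>

lemma cl_eq_mod_m:
  assumes "a \<in> m" "cl x a y u v = cl x a y u' v'"
  shows "u - u' \<in> m" "v - v' \<in> m"
  using assms xy_m m_add m_mult by (auto simp: cl_eq_iff)

lemma not_mfree_tri:
  assumes a: "a \<in> m"
  shows "\<not> mfree (tri x a y)"
proof
  assume "mfree (tri x a y)"
  moreover have "msmul (tri x a y) x (cl x a y 1 0) = mzero (tri x a y)"
    by (auto simp: cl_eq_zero_iff intro!: exI2[of _ 1 0])
  ultimately obtain w where "w \<in> mcarrier (tri x a y)" "cl x a y 1 0 = msmul (tri x a y) y w"
    using amodule.mfree_annihilator[OF amodule_tri _ cl_carrier _ ann_x] by blast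
  then obtain u v where "cl x a y 1 0 = cl x a y (y * u) (y * v)" by (auto simp: tri_carrier)
  then have "1 - y * u \<in> m" using cl_eq_mod_m[OF a] by blast
  then show False using m_add[of "1 - y * u" "y * u"] xy_m m_mult(2) one_notin_m by simp
qed

lemma not_miso_tri:
  assumes c: "c \<in> m"
    and gens: "\<And>n0 n1. tri_rel p a q (tri x c y) n0 n1 \<Longrightarrow>
      \<exists>u v u' v'. n0 = cl x c y u v \<and> n1 = cl x c y u' v' \<and> v \<in> m \<and> v' \<in> m"
  shows "\<not> miso (tri p a q) (tri x c y)"
proof
  assume "miso (tri p a q) (tri x c y)"
  then obtain f where f: "mlinear f (tri p a q) (tri x c y)"
    and bij: "bij_betw f (mcarrier (tri p a q)) (mcarrier (tri x c y))"
    by (auto simp: miso_def)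
  obtain u v u' v' where g: "f (cl p a q 1 0) = cl x c y u v" "f (cl p a q 0 1) = cl x c y u' v'" "v \<in> m" "v' \<in> m"
    using gens[OF amodule.mlinear_tri(1)[OF amodule_tri f]] by blast
  obtain X where X: "X \<in> mcarrier (tri p a q)" "f X = cl x c y 0 1"
    using bij cl_carrier unfolding bij_betw_def by (metis imageE)
  then obtain r s where "X = cl p a q r s" by (auto simp: tri_carrier)
  then have "cl x c y 0 1 = cl x c y (r * u + s * u') (r * v + s * v')"
    using X(2) amodule.mlinear_tri(2)[OF amodule_tri f, of r s] g by simp
  then have "1 - (r * v + s * v') \<in> m" using cl_eq_mod_m[OF c] by blast
  then show False
    using m_add[of "1 - (r * v + s * v')" "r * v + s * v'"] g m_mult m_add one_notin_m by simp
qed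

lemma not_miso_opposite:
  assumes "regular_mod x y c" "c \<in> m" "a \<in> m"
  shows "\<not> miso (tri y a x) (tri x c y)"
proof (rule not_miso_tri[OF assms(2)])
  fix n0 n1 assume "tri_rel y a x (tri x c y) n0 n1"
  from hom_opposite_rel[OF assms(1) this] obtain u v
    where "n0 = cl x c y 0 (- (x * v))" "n1 = cl x c y u (a * v)" by blast
  moreover have "- (x * v) \<in> m" "a * v \<in> m" using assms(3) xy_m m_mult m_minus by auto
  ultimately show "\<exists>u v u' v'. n0 = cl x c y u v \<and> n1 = cl x c y u' v' \<and> v \<in> m \<and> v' \<in> m" by blast
qed

text \<open>In the other direction the second generator can be reached (take \<open>v = 1\<close> in
  \<open>hom_up_rel\<close>), so this argument excludes isomorphisms only towards the smaller
  corner; symmetry of \<open>miso\<close> does the rest.\<close>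

lemma not_miso_down:
  assumes "regular_mod x y c" "c \<in> m" "e \<in> m"
  shows "\<not> miso (tri x (c * e) y) (tri x c y)"
proof (rule not_miso_tri[OF assms(2)])
  fix n0 n1 assume "tri_rel x (c * e) y (tri x c y) n0 n1"
  from hom_down_rel[OF assms(1) this] obtain u v
    where "n0 = cl x c y v 0" "n1 = cl x c y 0 (e * v + x * u)" by blast
  moreover have "e * v + x * u \<in> m" "0 \<in> m"
    using assms(3) xy_m m_mult m_add m_mult(1)[OF xy_m(1), of 0] by auto
  ultimately show "\<exists>u v u' v'. n0 = cl x c y u v \<and> n1 = cl x c y u' v' \<and> v \<in> m \<and> v' \<in> m" by blast
qed

text \<open>The components of the generators in a direct sum decomposition define an endomorphism,
  and every endomorphism is multiplication by a ring element.\<close>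

lemma indecomposable_tri:
  assumes a: "regular_mod x y a" "a \<in> m"
  shows "indecomposable (tri x a y)"
  unfolding indecomposable_def
proof (intro conjI allI impI)
  let ?M = "tri x a y" and ?e0 = "cl x a y 1 0" and ?e1 = "cl x a y 0 1"
  interpret M: amodule ?M by (rule amodule_tri)
  have "?e0 \<noteq> mzero ?M"
    unfolding tri_zero using cl_eq_mod_m(1)[OF a(2), of 1 0 0 0] one_notin_m by force
  moreover have "?e0 \<in> mcarrier ?M" by (rule cl_carrier)
  ultimately show "mcarrier ?M \<noteq> {mzero ?M}" by fast
  fix S T
  assume "submodule S ?M \<and> submodule T ?M \<and> {madd ?M s t | s t. s \<in> S \<and> t \<in> T} = mcarrier ?M
      \<and> S \<inter> T = {mzero ?M}"
  then have S: "submodule S ?M" and T: "submodule T ?M"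
    and sum: "{madd ?M s t | s t. s \<in> S \<and> t \<in> T} = mcarrier ?M" and int: "S \<inter> T = {mzero ?M}" by blast+
  have sub: "S \<subseteq> mcarrier ?M" "T \<subseteq> mcarrier ?M" using S T by (auto simp: submodule_def)
  \<comment> \<open>Uniqueness of the decomposition of zero. Applied to the relations of the
    generators, it shows that their \<open>S\<close>-components satisfy the same relations.\<close>
  have zero: "s = mzero ?M" if "s \<in> S" "t \<in> T" "madd ?M s t = mzero ?M" for s t
  proof -
    have tM: "t \<in> mcarrier ?M" and sM: "s \<in> mcarrier ?M" using that sub by auto
    have "madd ?M t s = madd ?M t (msmul ?M (- 1) t)"
      using that(3) M.add_neg[OF tM] M.add_comm[OF tM sM] by simp
    then have "s = msmul ?M (- 1) t" using M.add_left_cancel tM sM M.smul_closed by blast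
    then have "s \<in> T" using T that by (auto simp: submodule_def)
    then show ?thesis using int that by blast
  qed
  obtain s0 t0 where 0: "s0 \<in> S" "t0 \<in> T" "madd ?M s0 t0 = ?e0"
    using sum cl_carrier by (smt (verit, best) mem_Collect_eq)
  obtain s1 t1 where 1: "s1 \<in> S" "t1 \<in> T" "madd ?M s1 t1 = ?e1"
    using sum cl_carrier by (smt (verit, best) mem_Collect_eq)
  have M: "s0 \<in> mcarrier ?M" "t0 \<in> mcarrier ?M" "s1 \<in> mcarrier ?M" "t1 \<in> mcarrier ?M"
    using 0 1 sub by auto
  have "msmul ?M x s0 = mzero ?M"
  proof (rule zero)
    show "msmul ?M x s0 \<in> S" "msmul ?M x t0 \<in> T" using S T 0 by (auto simp: submodule_def)
    have "madd ?M (msmul ?M x s0) (msmul ?M x t0) = msmul ?M x ?e0"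
      unfolding 0(3)[symmetric] using M by (simp only: M.smul_add)
    then show "madd ?M (msmul ?M x s0) (msmul ?M x t0) = mzero ?M"
      by (auto simp: cl_eq_zero_iff intro!: exI2[of _ 1 0])
  qed
  moreover have "madd ?M (msmul ?M a s0) (msmul ?M y s1) = mzero ?M"
  proof (rule zero)
    show "madd ?M (msmul ?M a s0) (msmul ?M y s1) \<in> S" "madd ?M (msmul ?M a t0) (msmul ?M y t1) \<in> T"
      using S T 0 1 by (auto simp: submodule_def)
    have "madd ?M (madd ?M (msmul ?M a s0) (msmul ?M y s1)) (madd ?M (msmul ?M a t0) (msmul ?M y t1))
        = madd ?M (msmul ?M a ?e0) (msmul ?M y ?e1)"
      unfolding 0(3)[symmetric] 1(3)[symmetric] using M
      by (simp only: M.smul_add M.add_assoc M.add_left_commute M.smul_closed M.add_closed)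
    then show "madd ?M (madd ?M (msmul ?M a s0) (msmul ?M y s1)) (madd ?M (msmul ?M a t0) (msmul ?M y t1)) = mzero ?M"
      by (auto simp: cl_eq_zero_iff intro!: exI2[of _ 0 1])
  qed
  \<comment> \<open>The projection to \<open>S\<close> is an endomorphism; writing the corner as
    \<open>a * 1\<close> makes it the case \<open>e = 1\<close> of
    \<open>hom_up_rel\<close>.\<close>
  ultimately have "tri_rel x a y (tri x (a * 1) y) s0 s1"
    using M by (simp add: tri_rel_def)
  from hom_up_rel[OF a(1) this] obtain u v where
    s: "s0 = cl x a y (v + y * u) 0" "s1 = cl x a y (- (a * u)) v" by auto
  \<comment> \<open>The relation \<open>(a, y)\<close> lets \<open>y * u\<close> times the second
    generator replace \<open>- (a * u)\<close> times the first, so both generators are multiplied by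
    the same \<open>k\<close>.\<close>
  define k where "k = v + y * u"
  have k: "s0 = msmul ?M k ?e0" "s1 = msmul ?M k ?e1"
    unfolding s k_def by (auto simp: cl_eq_iff algebra_simps intro!: exI2[of _ 0 "- u"])
  have t: "t0 = msmul ?M (1 - k) ?e0" "t1 = msmul ?M (1 - k) ?e1"
  proof -
    have "madd ?M s0 t0 = madd ?M s0 (msmul ?M (1 - k) ?e0)" unfolding 0(3) by (simp add: k)
    then show "t0 = msmul ?M (1 - k) ?e0"
      by (rule M.add_left_cancel[OF M(1) M(2) M.smul_closed[OF cl_carrier]])
    have "madd ?M s1 t1 = madd ?M s1 (msmul ?M (1 - k) ?e1)" unfolding 1(3) by (simp add: k)
    then show "t1 = msmul ?M (1 - k) ?e1"
      by (rule M.add_left_cancel[OF M(3) M(4) M.smul_closed[OF cl_carrier]])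
  qed
  have full: "mcarrier ?M \<subseteq> U" if U: "submodule U ?M" "msmul ?M l ?e0 \<in> U" "msmul ?M l ?e1 \<in> U" "l * r = 1" for U l r
  proof
    fix X assume "X \<in> mcarrier ?M"
    then obtain u v where X: "X = cl x a y u v" by (auto simp: tri_carrier)
    have "\<And>X Y. X \<in> U \<Longrightarrow> Y \<in> U \<Longrightarrow> madd ?M X Y \<in> U" "\<And>X s. X \<in> U \<Longrightarrow> msmul ?M s X \<in> U"
      using U(1) unfolding submodule_def by blast+
    then have "madd ?M (msmul ?M (u * r) (msmul ?M l ?e0)) (msmul ?M (v * r) (msmul ?M l ?e1)) \<in> U"
      using U(2,3) by metis
    moreover have "u * r * l = u" "v * r * l = v" using U(4) by (simp_all add: mult.assoc mult.commute[of r])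
    ultimately show "X \<in> U" by (simp add: X)
  qed
  show "S = {mzero ?M} \<or> T = {mzero ?M}"
  proof (rule unit_cases[of k])
    fix r assume "k * r = 1"
    then have "mcarrier ?M \<subseteq> S" using full[OF S] k 0 1 by auto
    then show ?thesis using int sub by auto
  next
    fix r assume "(1 - k) * r = 1"
    then have "mcarrier ?M \<subseteq> T" using full[OF T] t 0 1 by auto
    then show ?thesis using int sub by auto
  qed
qed

end

subsection \<open>Comparison of free resolutions\<close>

lemma mlinear_add: "mlinear f M N \<Longrightarrow> u \<in> mcarrier M \<Longrightarrow> v \<in> mcarrier M \<Longrightarrow> f (madd M u v) = madd N (f u) (f v)"
  and mlinear_smul: "mlinear f M N \<Longrightarrow> u \<in> mcarrier M \<Longrightarrow> f (msmul M r u) = msmul N r (f u)"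
  by (simp_all add: mlinear_def)

lemma mlinearI:
  assumes "\<And>u. u \<in> mcarrier M \<Longrightarrow> f u \<in> mcarrier N"
    and "\<And>u v. u \<in> mcarrier M \<Longrightarrow> v \<in> mcarrier M \<Longrightarrow> f (madd M u v) = madd N (f u) (f v)"
    and "\<And>r u. u \<in> mcarrier M \<Longrightarrow> f (msmul M r u) = msmul N r (f u)"
  shows "mlinear f M N"
  using assms by (simp add: mlinear_def)

lemma mlinear_comp: "mlinear f M N \<Longrightarrow> mlinear g N P \<Longrightarrow> mlinear (\<lambda>u. g (f u)) M P"
  by (simp add: mlinear_def)

lemma mlinear_plus:
  assumes "amodule N" "mlinear f M N" "mlinear g M N"
  shows "mlinear (\<lambda>u. madd N (f u) (g u)) M N"
proof -
  interpret amodule N by fact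
  show ?thesis
    using assms(2,3)
    by (intro mlinearI) (simp_all add: mlinear_def add_closed smul_closed smul_add add_assoc add_left_commute)
qed

lemma mlinear_scale:
  assumes "amodule N" "mlinear f M N"
  shows "mlinear (\<lambda>u. msmul N r (f u)) M N"
proof -
  interpret amodule N by fact
  show ?thesis
    using assms(2)
    by (intro mlinearI) (simp_all add: mlinear_def smul_closed smul_add smul_smul mult.commute)
qed

lemma mlinear_zero:
  assumes "amodule M" "amodule N" "mlinear f M N"
  shows "f (mzero M) = mzero N"
proof -
  have "f (msmul M 0 (mzero M)) = msmul N 0 (f (mzero M))"
    by (rule mlinear_smul[OF assms(3) amodule.zero_closed[OF assms(1)]])
  then show ?thesis
    using assms by (metis amodule.smul_zero amodule.zero_closed amodule.zero_smul mlinear_closed)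
qed

lemma mlinear_restrict:
  assumes "amodule M" "mlinear f M N"
  shows "mlinear (\<lambda>u. if u \<in> mcarrier M then f u else z) M N"
proof -
  interpret amodule M by fact
  show ?thesis using assms(2) by (intro mlinearI) (simp_all add: mlinear_def add_closed smul_closed)
qed

lemma mlinear_matmap: "mlinear (matmap m k D) (fmod k) (fmod m)"
  by (rule mlinearI) (auto simp: fmod_def matmap_def fun_eq_iff sum.distrib sum_distrib_left algebra_simps)

text \<open>Projectivity of A^k, lifting one basis vector at a time.\<close>

lemma fmod_lift:
  assumes p: "mlinear p (fmod n) N" and g: "mlinear g (fmod k) N"
    and img: "\<And>v. v \<in> mcarrier (fmod k) \<Longrightarrow> g v \<in> p ` mcarrier (fmod n)"
  shows "\<exists>f. mlinear f (fmod k) (fmod n) \<and> (\<forall>v\<in>mcarrier (fmod k). p (f v) = g v)"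
  using g img
proof (induction k)
  case 0
  interpret P: amodule "fmod n :: ('a, _) amod" by (rule amodule_fmod)
  have car: "mcarrier (fmod 0) = {\<lambda>i. 0 :: 'a}" by (auto simp: fmod_def)
  \<comment> \<open>\<open>N\<close> is an arbitrary record, so that both maps agree at zero comes
    from linearity: each value is 0 times \<open>p w\<close>.\<close>
  have "p (mzero (fmod n)) = g (\<lambda>i. 0)"
  proof -
    obtain w where w: "w \<in> mcarrier (fmod n)" "p w = g (\<lambda>i. 0)" using 0(2)[of "\<lambda>i. 0"] car by auto
    have "g (msmul (fmod 0) 0 (\<lambda>i. 0)) = msmul N 0 (g (\<lambda>i. 0))"
      using 0(1) car by (simp add: mlinear_def)
    then have "g (\<lambda>i. 0) = msmul N 0 (p w)" by (simp add: w fmod_def)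
    then show ?thesis using mlinear_smul[OF p w(1), of 0] w P.zero_smul by simp
  qed
  moreover have "mlinear (\<lambda>v. mzero (fmod n)) (fmod 0 :: ('a, _) amod) (fmod n :: ('a, _) amod)"
    by (rule mlinearI) (simp_all only: P.zero_closed P.add_zero P.smul_zero)
  ultimately show ?case using car by (intro exI[of _ "\<lambda>v. mzero (fmod n)"]) auto
next
  case (Suc k)
  interpret P: amodule "fmod n :: ('a, _) amod" by (rule amodule_fmod)
  let ?e = "\<lambda>i. if i = k then 1 else (0::'a)"
  have sub: "v \<in> mcarrier (fmod (Suc k))" if "v \<in> mcarrier (fmod k)" for v :: "nat \<Rightarrow> 'a"
    using that by (auto simp: fmod_def)
  have e: "?e \<in> mcarrier (fmod (Suc k))" by (simp add: fmod_def)
  have res: "v(k := 0) \<in> mcarrier (fmod k)" if "v \<in> mcarrier (fmod (Suc k))" for v :: "nat \<Rightarrow> 'a"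
    using that by (auto simp: fmod_def)
  have "mlinear g (fmod k) N"
    using Suc.prems(1) sub unfolding mlinear_def by (simp add: fmod_def)
  then obtain f where f: "mlinear f (fmod k) (fmod n)" "\<And>v. v \<in> mcarrier (fmod k) \<Longrightarrow> p (f v) = g v"
    using Suc.IH Suc.prems(2) sub by blast
  obtain w where w: "w \<in> mcarrier (fmod n)" "p w = g ?e" using Suc.prems(2)[OF e] by auto
  define f' where "f' v = madd (fmod n) (f (v(k := 0))) (msmul (fmod n) (v k) w)" for v
  have fc: "f (v(k := 0)) \<in> mcarrier (fmod n)" if "v \<in> mcarrier (fmod (Suc k))" for v
    using f(1) res[OF that] by (rule mlinear_closed)
  have "mlinear f' (fmod (Suc k)) (fmod n)"
  proof (rule mlinearI)
    fix u v :: "nat \<Rightarrow> 'a" and r assume u: "u \<in> mcarrier (fmod (Suc k))"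
    show "f' u \<in> mcarrier (fmod n)" unfolding f'_def using fc[OF u] w by (simp add: P.add_closed P.smul_closed)
    have "(msmul (fmod (Suc k)) r u)(k := 0) = msmul (fmod k) r (u(k := 0))" "msmul (fmod (Suc k)) r u k = r * u k"
      by (auto simp: fmod_def)
    then show "f' (msmul (fmod (Suc k)) r u) = msmul (fmod n) r (f' u)"
      unfolding f'_def using mlinear_smul[OF f(1) res[OF u]] fc[OF u] w
      by (simp add: P.smul_add P.smul_smul P.smul_closed)
    assume v: "v \<in> mcarrier (fmod (Suc k))"
    have "(madd (fmod (Suc k)) u v)(k := 0) = madd (fmod k) (u(k := 0)) (v(k := 0))"
      "madd (fmod (Suc k)) u v k = u k + v k"
      by (auto simp: fmod_def)
    then show "f' (madd (fmod (Suc k)) u v) = madd (fmod n) (f' u) (f' v)"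
      unfolding f'_def using mlinear_add[OF f(1) res[OF u] res[OF v]] fc[OF u] fc[OF v] w
      by (simp add: P.add_smul P.add_assoc P.add_left_commute P.smul_closed P.add_closed)
  qed
  moreover have "p (f' v) = g v" if v: "v \<in> mcarrier (fmod (Suc k))" for v
  proof -
    have "v = madd (fmod (Suc k)) (v(k := 0)) (msmul (fmod (Suc k)) (v k) ?e)"
      by (auto simp: fmod_def fun_eq_iff)
    then have "g v = g (madd (fmod (Suc k)) (v(k := 0)) (msmul (fmod (Suc k)) (v k) ?e))" by simp
    also have "\<dots> = madd N (g (v(k := 0))) (msmul N (v k) (g ?e))"
      by (simp only: mlinear_add[OF Suc.prems(1) sub[OF res[OF v]] amodule.smul_closed[OF amodule_fmod e]]
          mlinear_smul[OF Suc.prems(1) e])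
    also have "\<dots> = p (f' v)"
      unfolding f'_def using mlinear_add[OF p fc[OF v] P.smul_closed[OF w(1)]] mlinear_smul[OF p w(1)]
        f(2)[OF res[OF v]] w(2) by simp
    finally show ?thesis by simp
  qed
  ultimately show ?case by blast
qed

text \<open>One step of the comparison of two resolutions: \<open>h\<close> and \<open>h'\<close> form a homotopy
  between \<open>g \<circ> f\<close> and the identity, which is only needed on boundaries in the lower degree.\<close>

lemma comparison_step:
  fixes D0 D1 E0 E1 f g h :: "(nat \<Rightarrow> 'a::comm_ring_1) \<Rightarrow> nat \<Rightarrow> 'a"
  assumes D0: "mlinear D0 (fmod n1) (fmod n0)" and D1: "mlinear D1 (fmod n2) (fmod n1)"
    and D_exact: "\<And>v. v \<in> mcarrier (fmod n1) \<Longrightarrow> D0 v = mzero (fmod n0) \<Longrightarrow> v \<in> D1 ` mcarrier (fmod n2)"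
    and E0: "mlinear E0 (fmod k1) (fmod k0)"
    and f: "mlinear f (fmod n0) (fmod k0)" and g: "mlinear g (fmod k0) (fmod n0)"
    and h: "mlinear h (fmod n0) (fmod n1)"
    and fD: "\<And>v. v \<in> mcarrier (fmod n1) \<Longrightarrow> f (D0 v) \<in> E0 ` mcarrier (fmod k1)"
    and gE: "\<And>v. v \<in> mcarrier (fmod k1) \<Longrightarrow> g (E0 v) \<in> D0 ` mcarrier (fmod n1)"
    and homotopy: "\<And>v. v \<in> mcarrier (fmod n1) \<Longrightarrow> g (f (D0 v)) = madd (fmod n0) (D0 v) (D0 (h (D0 v)))"
  obtains f' g' h' where "mlinear f' (fmod n1) (fmod k1)" "mlinear g' (fmod k1) (fmod n1)"
    "mlinear h' (fmod n1) (fmod n2)"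
    "\<And>v. v \<in> mcarrier (fmod n1) \<Longrightarrow> E0 (f' v) = f (D0 v)"
    "\<And>v. v \<in> mcarrier (fmod k1) \<Longrightarrow> D0 (g' v) = g (E0 v)"
    "\<And>v. v \<in> mcarrier (fmod n1) \<Longrightarrow>
      g' (f' v) = madd (fmod n1) (madd (fmod n1) v (h (D0 v))) (D1 (h' v))"
proof -
  interpret F0: amodule "fmod n0 :: ('a, _) amod" by (rule amodule_fmod)
  interpret F1: amodule "fmod n1 :: ('a, _) amod" by (rule amodule_fmod)
  obtain f' where f': "mlinear f' (fmod n1) (fmod k1)" "\<And>v. v \<in> mcarrier (fmod n1) \<Longrightarrow> E0 (f' v) = f (D0 v)"
    using fmod_lift[OF E0 mlinear_comp[OF D0 f] fD] by blast
  obtain g' where g': "mlinear g' (fmod k1) (fmod n1)" "\<And>v. v \<in> mcarrier (fmod k1) \<Longrightarrow> D0 (g' v) = g (E0 v)"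
    using fmod_lift[OF D0 mlinear_comp[OF E0 g] gE] by blast
  let ?s = "\<lambda>v. madd (fmod n1) v (h (D0 v))"
  \<comment> \<open>The deviation of \<open>g' \<circ> f'\<close> from the identity plus
    \<open>h \<circ> D0\<close>. By \<open>homotopy\<close> it is killed by \<open>D0\<close>, so it
    lifts through \<open>D1\<close>, and the lift is the new homotopy.\<close>
  define r where "r v = madd (fmod n1) (g' (f' v)) (msmul (fmod n1) (- 1) (?s v))" for v
  have s: "mlinear ?s (fmod n1) (fmod n1)"
    by (rule mlinear_plus[OF amodule_fmod _ mlinear_comp[OF D0 h]]) (simp add: mlinear_def)
  have gf: "mlinear (\<lambda>v. g' (f' v)) (fmod n1) (fmod n1)" using f'(1) g'(1) by (rule mlinear_comp)
  have r: "mlinear r (fmod n1) (fmod n1)"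
    unfolding r_def by (intro mlinear_plus mlinear_scale amodule_fmod s gf)
  have D0c: "D0 v \<in> mcarrier (fmod n0)" if "v \<in> mcarrier (fmod n1)" for v using mlinear_closed[OF D0 that] .
  have hc: "h (D0 v) \<in> mcarrier (fmod n1)" if "v \<in> mcarrier (fmod n1)" for v
    using mlinear_closed[OF mlinear_comp[OF D0 h] that] .
  have "r v \<in> D1 ` mcarrier (fmod n2)" if v: "v \<in> mcarrier (fmod n1)" for v
  proof (rule D_exact)
    show "r v \<in> mcarrier (fmod n1)" using r v by (rule mlinear_closed)
    have "D0 (g' (f' v)) = D0 (?s v)"
      using v hc g'(2)[OF mlinear_closed[OF f'(1) v]] f'(2) homotopy mlinear_add[OF D0] by simp
    moreover have "D0 (r v) = madd (fmod n0) (D0 (g' (f' v))) (msmul (fmod n0) (- 1) (D0 (?s v)))"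
      unfolding r_def using mlinear_closed[OF gf v] mlinear_closed[OF s v] F1.smul_closed
      by (simp only: mlinear_add[OF D0] mlinear_smul[OF D0])
    ultimately show "D0 (r v) = mzero (fmod n0)"
      using F0.add_neg D0c[OF mlinear_closed[OF s v]] by simp
  qed
  then obtain h' where h': "mlinear h' (fmod n1) (fmod n2)" "\<And>v. v \<in> mcarrier (fmod n1) \<Longrightarrow> D1 (h' v) = r v"
    using fmod_lift[OF D1 r] by blast
  have "g' (f' v) = madd (fmod n1) (?s v) (D1 (h' v))" if v: "v \<in> mcarrier (fmod n1)" for v
  proof -
    have c: "?s v \<in> mcarrier (fmod n1)" "g' (f' v) \<in> mcarrier (fmod n1)"
      using mlinear_closed[OF s v] mlinear_closed[OF gf v] by auto
    have "madd (fmod n1) (?s v) (r v) = madd (fmod n1) (g' (f' v)) (madd (fmod n1) (?s v) (msmul (fmod n1) (- 1) (?s v)))"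
      unfolding r_def using c F1.smul_closed F1.add_left_commute by blast
    then show ?thesis using c h'(2)[OF v] F1.add_neg F1.add_zero by simp
  qed
  then show thesis using that[OF f'(1) g'(1) h'(1)] f'(2) g'(2) by blast
qed

text \<open>Ext does not depend on the resolution: exactness of the dual of one resolution,
  hypothesis \<open>acyclic\<close>, carries over to every other one along a homotopy
  equivalence.\<close>

lemma ext_zero_resolution:
  fixes M :: "('a::comm_ring_1, 'm) amod"
  assumes M: "amodule M" and P: "free_res M k e eta" and i: "i > 0"
    and acyclic: "\<And>i phi. i > 0 \<Longrightarrow> mlinear phi (fmod (k i)) ring_mod \<Longrightarrow>
      (\<And>v. v \<in> mcarrier (fmod (k (Suc i))) \<Longrightarrow> phi (matmap (k i) (k (Suc i)) (e (Suc i)) v) = 0) \<Longrightarrow>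
      \<exists>psi. mlinear psi (fmod (k (i - 1))) ring_mod \<and>
        (\<forall>v\<in>mcarrier (fmod (k i)). phi v = psi (matmap (k (i - 1)) (k i) (e i) v))"
  shows "ext_zero i M"
  unfolding ext_zero_def
proof (intro allI impI)
  fix n d eps assume F: "free_res M n d eps"
  interpret M: amodule M by (rule M)
  define D where "D j = matmap (n j) (n (Suc j)) (d (Suc j))" for j
  define E where "E j = matmap (k j) (k (Suc j)) (e (Suc j))" for j
  have D: "mlinear (D j) (fmod (n (Suc j))) (fmod (n j))" for j unfolding D_def by (rule mlinear_matmap)
  have E: "mlinear (E j) (fmod (k (Suc j))) (fmod (k j))" for j unfolding E_def by (rule mlinear_matmap)
  have eps: "mlinear eps (fmod (n 0)) M" "eps ` mcarrier (fmod (n 0)) = mcarrier M"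
    "{v \<in> mcarrier (fmod (n 0)). eps v = mzero M} = D 0 ` mcarrier (fmod (n 1))"
    using F by (simp_all add: free_res_def D_def)
  have eta: "mlinear eta (fmod (k 0)) M" "eta ` mcarrier (fmod (k 0)) = mcarrier M"
    "{v \<in> mcarrier (fmod (k 0)). eta v = mzero M} = E 0 ` mcarrier (fmod (k 1))"
    using P by (simp_all add: free_res_def E_def)
  have D_ex: "{v \<in> mcarrier (fmod (n (Suc j))). D j v = mzero (fmod (n j))} = D (Suc j) ` mcarrier (fmod (n (Suc (Suc j))))" for j
    using F unfolding free_res_def D_def by (auto dest!: spec[of _ "Suc j"])
  have E_ex: "{v \<in> mcarrier (fmod (k (Suc j))). E j v = mzero (fmod (k j))} = E (Suc j) ` mcarrier (fmod (k (Suc (Suc j))))" for j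
    using P unfolding free_res_def E_def by (auto dest!: spec[of _ "Suc j"])
  have D_D: "D j (D (Suc j) v) = mzero (fmod (n j))" "D (Suc j) v \<in> mcarrier (fmod (n (Suc j)))"
    if "v \<in> mcarrier (fmod (n (Suc (Suc j))))" for j v
    using D_ex[of j] that by blast+
  have E_E: "E j (E (Suc j) v) = mzero (fmod (k j))" "E (Suc j) v \<in> mcarrier (fmod (k (Suc j)))"
    if "v \<in> mcarrier (fmod (k (Suc (Suc j))))" for j v
    using E_ex[of j] that by blast+
  have D_exact: "v \<in> D (Suc j) ` mcarrier (fmod (n (Suc (Suc j))))"
    if "v \<in> mcarrier (fmod (n (Suc j)))" "D j v = mzero (fmod (n j))" for j v
    using D_ex[of j] that by blast
  have E_exact: "v \<in> E (Suc j) ` mcarrier (fmod (k (Suc (Suc j))))"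
    if "v \<in> mcarrier (fmod (k (Suc j)))" "E j v = mzero (fmod (k j))" for j v
    using E_ex[of j] that by blast
  \<comment> \<open>The invariant speaks only of degree \<open>j\<close> and of boundaries there, so
    the maps of different degrees need not be collected into one coherent family.\<close>
  have comparison: "\<exists>f g h. mlinear f (fmod (n j)) (fmod (k j)) \<and> mlinear g (fmod (k j)) (fmod (n j))
     \<and> mlinear h (fmod (n j)) (fmod (n (Suc j)))
     \<and> (\<forall>v\<in>mcarrier (fmod (n (Suc j))). f (D j v) \<in> E j ` mcarrier (fmod (k (Suc j))))
     \<and> (\<forall>v\<in>mcarrier (fmod (k (Suc j))). g (E j v) \<in> D j ` mcarrier (fmod (n (Suc j))))
     \<and> (\<forall>v\<in>mcarrier (fmod (n (Suc j))). g (f (D j v)) = madd (fmod (n j)) (D j v) (D j (h (D j v))))" for j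
  proof (induction j)
    case 0
    interpret F0: amodule "fmod (n 0) :: ('a, _) amod" by (rule amodule_fmod)
    obtain f where f: "mlinear f (fmod (n 0)) (fmod (k 0))" "\<And>v. v \<in> mcarrier (fmod (n 0)) \<Longrightarrow> eta (f v) = eps v"
      using fmod_lift[OF eta(1) eps(1)] mlinear_closed[OF eps(1)] eta(2) by blast
    obtain g where g: "mlinear g (fmod (k 0)) (fmod (n 0))" "\<And>v. v \<in> mcarrier (fmod (k 0)) \<Longrightarrow> eps (g v) = eta v"
      using fmod_lift[OF eps(1) eta(1)] mlinear_closed[OF eta(1)] eps(2) by blast
    have fc: "f v \<in> mcarrier (fmod (k 0))" if "v \<in> mcarrier (fmod (n 0))" for v using mlinear_closed[OF f(1) that] .
    have gc: "g v \<in> mcarrier (fmod (n 0))" if "v \<in> mcarrier (fmod (k 0))" for v using mlinear_closed[OF g(1) that] .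
    define r where "r v = madd (fmod (n 0)) (g (f v)) (msmul (fmod (n 0)) (- 1) v)" for v
    have r: "mlinear r (fmod (n 0)) (fmod (n 0))"
      unfolding r_def
      by (intro mlinear_plus mlinear_scale amodule_fmod mlinear_comp[OF f(1) g(1)]) (simp add: mlinear_def)
    have "r v \<in> D 0 ` mcarrier (fmod (n (Suc 0)))" if v: "v \<in> mcarrier (fmod (n 0))" for v
    proof -
      have "eps (r v) = madd M (eps v) (msmul M (- 1) (eps v))"
        unfolding r_def using v fc gc f(2) g(2) F0.smul_closed
        by (simp only: mlinear_add[OF eps(1)] mlinear_smul[OF eps(1)])
      then have "eps (r v) = mzero M" using M.add_neg mlinear_closed[OF eps(1) v] by simp
      then show ?thesis using eps(3) mlinear_closed[OF r v] by auto
    qed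
    then obtain h where h: "mlinear h (fmod (n 0)) (fmod (n (Suc 0)))"
      "\<And>v. v \<in> mcarrier (fmod (n 0)) \<Longrightarrow> D 0 (h v) = r v"
      using fmod_lift[OF D r] by blast
    have gf: "g (f v) = madd (fmod (n 0)) v (D 0 (h v))" if v: "v \<in> mcarrier (fmod (n 0))" for v
    proof -
      have "madd (fmod (n 0)) v (r v) = madd (fmod (n 0)) (g (f v)) (madd (fmod (n 0)) v (msmul (fmod (n 0)) (- 1) v))"
        unfolding r_def using F0.add_left_commute v gc fc F0.smul_closed by blast
      then show ?thesis using v h(2) F0.add_neg F0.add_zero gc fc by simp
    qed
    have im: "D 0 v \<in> mcarrier (fmod (n 0))" "eps (D 0 v) = mzero M" if "v \<in> mcarrier (fmod (n (Suc 0)))" for v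
      using eps(3) that by auto
    have im': "E 0 v \<in> mcarrier (fmod (k 0))" "eta (E 0 v) = mzero M" if "v \<in> mcarrier (fmod (k (Suc 0)))" for v
      using eta(3) that by auto
    have "f (D 0 v) \<in> E 0 ` mcarrier (fmod (k (Suc 0)))" if "v \<in> mcarrier (fmod (n (Suc 0)))" for v
      using eta(3) im[OF that] f(2) fc by auto
    moreover have "g (E 0 v) \<in> D 0 ` mcarrier (fmod (n (Suc 0)))" if "v \<in> mcarrier (fmod (k (Suc 0)))" for v
      using eps(3) im'[OF that] g(2) gc by auto
    ultimately show ?case using f(1) g(1) h(1) gf im(1) by (intro exI[of _ f] exI[of _ g] exI[of _ h]) simp
  next
    case (Suc j)
    interpret F1: amodule "fmod (n (Suc j)) :: ('a, _) amod" by (rule amodule_fmod)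
    obtain f g h where f: "mlinear f (fmod (n j)) (fmod (k j))" and g: "mlinear g (fmod (k j)) (fmod (n j))"
     and h: "mlinear h (fmod (n j)) (fmod (n (Suc j)))"
     and fgh: "\<And>v. v \<in> mcarrier (fmod (n (Suc j))) \<Longrightarrow> f (D j v) \<in> E j ` mcarrier (fmod (k (Suc j)))"
      "\<And>v. v \<in> mcarrier (fmod (k (Suc j))) \<Longrightarrow> g (E j v) \<in> D j ` mcarrier (fmod (n (Suc j)))"
      "\<And>v. v \<in> mcarrier (fmod (n (Suc j))) \<Longrightarrow> g (f (D j v)) = madd (fmod (n j)) (D j v) (D j (h (D j v)))"
      using Suc.IH by blast
    obtain f' g' h' where f': "mlinear f' (fmod (n (Suc j))) (fmod (k (Suc j)))"
      and g': "mlinear g' (fmod (k (Suc j))) (fmod (n (Suc j)))"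
      and h': "mlinear h' (fmod (n (Suc j))) (fmod (n (Suc (Suc j))))"
      and fgh': "\<And>v. v \<in> mcarrier (fmod (n (Suc j))) \<Longrightarrow> E j (f' v) = f (D j v)"
      "\<And>v. v \<in> mcarrier (fmod (k (Suc j))) \<Longrightarrow> D j (g' v) = g (E j v)"
      "\<And>v. v \<in> mcarrier (fmod (n (Suc j))) \<Longrightarrow>
        g' (f' v) = madd (fmod (n (Suc j))) (madd (fmod (n (Suc j))) v (h (D j v))) (D (Suc j) (h' v))"
      using comparison_step[OF D D D_exact E f g h fgh] by blast
    note zero = mlinear_zero[OF amodule_fmod amodule_fmod]
    have "f' (D (Suc j) v) \<in> E (Suc j) ` mcarrier (fmod (k (Suc (Suc j))))"
      if "v \<in> mcarrier (fmod (n (Suc (Suc j))))" for v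
      using D_D[OF that] fgh'(1) zero[OF f] mlinear_closed[OF f'] by (intro E_exact) simp_all
    moreover have "g' (E (Suc j) v) \<in> D (Suc j) ` mcarrier (fmod (n (Suc (Suc j))))"
      if "v \<in> mcarrier (fmod (k (Suc (Suc j))))" for v
      using E_E[OF that] fgh'(2) zero[OF g] mlinear_closed[OF g'] by (intro D_exact) simp_all
    \<comment> \<open>On a boundary the term with \<open>h\<close> disappears, since two consecutive
      differentials compose to zero.\<close>
    moreover have "g' (f' (D (Suc j) v)) = madd (fmod (n (Suc j))) (D (Suc j) v) (D (Suc j) (h' (D (Suc j) v)))"
      if "v \<in> mcarrier (fmod (n (Suc (Suc j))))" for v
      using D_D[OF that] fgh'(3) zero[OF h] F1.add_zero by (simp only:)
    ultimately show ?case using f' g' h' by blast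
  qed
  obtain j where j: "i = Suc j" using i by (cases i) auto
  let ?C = "{phi \<in> mcarrier (hom_mod (fmod (n i)) ring_mod).
        dual_pre (n (Suc i)) (n i) (d (Suc i)) phi = mzero (hom_mod (fmod (n (Suc i))) ring_mod)}"
  show "?C = dual_pre (n i) (n (i - 1)) (d i) ` mcarrier (hom_mod (fmod (n (i - 1))) ring_mod)"
  proof (intro equalityI subsetI)
    fix phi assume "phi \<in> ?C"
    then have phi: "mlinear phi (fmod (n (Suc j))) ring_mod" and ext: "\<And>v. v \<notin> mcarrier (fmod (n (Suc j))) \<Longrightarrow> phi v = 0"
      and pre: "dual_pre (n (Suc i)) (n i) (d (Suc i)) phi = (\<lambda>v. 0)"
      by (simp_all add: hom_mod_def j ring_mod_def)
    have cocycle: "phi (D (Suc j) v) = 0" if "v \<in> mcarrier (fmod (n (Suc (Suc j))))" for v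
      using fun_cong[OF pre, of v] that by (simp add: dual_pre_def D_def j)
    obtain f g h where f: "mlinear f (fmod (n j)) (fmod (k j))" and g: "mlinear g (fmod (k j)) (fmod (n j))"
     and h: "mlinear h (fmod (n j)) (fmod (n (Suc j)))"
     and fgh: "\<And>v. v \<in> mcarrier (fmod (n (Suc j))) \<Longrightarrow> f (D j v) \<in> E j ` mcarrier (fmod (k (Suc j)))"
      "\<And>v. v \<in> mcarrier (fmod (k (Suc j))) \<Longrightarrow> g (E j v) \<in> D j ` mcarrier (fmod (n (Suc j)))"
      "\<And>v. v \<in> mcarrier (fmod (n (Suc j))) \<Longrightarrow> g (f (D j v)) = madd (fmod (n j)) (D j v) (D j (h (D j v)))"
      using comparison[of j] by blast
    obtain f' g' h' where f': "mlinear f' (fmod (n (Suc j))) (fmod (k (Suc j)))"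
      and g': "mlinear g' (fmod (k (Suc j))) (fmod (n (Suc j)))"
      and h': "mlinear h' (fmod (n (Suc j))) (fmod (n (Suc (Suc j))))"
      and fgh': "\<And>v. v \<in> mcarrier (fmod (n (Suc j))) \<Longrightarrow> E j (f' v) = f (D j v)"
      "\<And>v. v \<in> mcarrier (fmod (k (Suc j))) \<Longrightarrow> D j (g' v) = g (E j v)"
      "\<And>v. v \<in> mcarrier (fmod (n (Suc j))) \<Longrightarrow>
        g' (f' v) = madd (fmod (n (Suc j))) (madd (fmod (n (Suc j))) v (h (D j v))) (D (Suc j) (h' v))"
      using comparison_step[OF D D D_exact E f g h fgh] by blast
    have "phi (g' (E (Suc j) v)) = 0" if "v \<in> mcarrier (fmod (k (Suc (Suc j))))" for v
    proof -
      have "g' (E (Suc j) v) \<in> D (Suc j) ` mcarrier (fmod (n (Suc (Suc j))))"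
        using E_E[OF that] fgh'(2) mlinear_zero[OF amodule_fmod amodule_fmod g] mlinear_closed[OF g']
        by (intro D_exact) simp_all
      then show ?thesis using cocycle by auto
    qed
    then obtain psi where psi: "mlinear psi (fmod (k j)) ring_mod"
      "\<And>v. v \<in> mcarrier (fmod (k (Suc j))) \<Longrightarrow> phi (g' v) = psi (E j v)"
      using acyclic[of "Suc j", OF _ mlinear_comp[OF g' phi]] by (auto simp: E_def)
    \<comment> \<open>Evaluate \<open>phi (g' (f' v))\<close> twice: it is
      \<open>psi (f (D j v))\<close>, and by the homotopy it is
      \<open>phi v + phi (h (D j v))\<close>, as the cocycle \<open>phi\<close> kills boundaries.
      The difference exhibits \<open>phi\<close> as a coboundary.\<close>
    let ?chi = "\<lambda>u. psi (f u) + - 1 * phi (h u)"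
    have "mlinear (\<lambda>u. madd ring_mod (psi (f u)) (msmul ring_mod (- 1) (phi (h u)))) (fmod (n j)) ring_mod"
      by (intro mlinear_plus mlinear_scale amodule_ring_mod mlinear_comp[OF f psi(1)] mlinear_comp[OF h phi])
    then have chi: "mlinear ?chi (fmod (n j)) ring_mod" by (simp add: ring_mod_def)
    define chi where "chi u = (if u \<in> mcarrier (fmod (n j)) then ?chi u else 0)" for u
    have "mlinear chi (fmod (n j)) ring_mod"
      unfolding chi_def using amodule_fmod chi by (rule mlinear_restrict)
    then have chi_mem: "chi \<in> mcarrier (hom_mod (fmod (n (i - 1))) ring_mod)"
      by (simp add: hom_mod_def j chi_def ring_mod_def)
    have "phi v = chi (D j v)" if v: "v \<in> mcarrier (fmod (n (Suc j)))" for v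
    proof -
      have Dv: "D j v \<in> mcarrier (fmod (n j))" using mlinear_closed[OF D v] .
      have hv: "h (D j v) \<in> mcarrier (fmod (n (Suc j)))" using mlinear_closed[OF h Dv] .
      have h'v: "D (Suc j) (h' v) \<in> mcarrier (fmod (n (Suc j)))" using mlinear_closed[OF D mlinear_closed[OF h' v]] .
      have add: "phi (madd (fmod (n (Suc j))) u w) = phi u + phi w"
        if "u \<in> mcarrier (fmod (n (Suc j)))" "w \<in> mcarrier (fmod (n (Suc j)))" for u w
        using mlinear_add[OF phi that] by (simp add: ring_mod_def)
      have "psi (f (D j v)) = phi (g' (f' v))"
        using psi(2)[OF mlinear_closed[OF f' v]] fgh'(1)[OF v] by simp
      also have "\<dots> = phi v + phi (h (D j v)) + phi (D (Suc j) (h' v))"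
        using add v hv h'v amodule.add_closed[OF amodule_fmod v hv] fgh'(3)[OF v] by simp
      finally show ?thesis using cocycle[OF mlinear_closed[OF h' v]] Dv by (simp add: chi_def)
    qed
    then have "phi = dual_pre (n i) (n (i - 1)) (d i) chi"
      using ext by (auto simp: dual_pre_def fun_eq_iff j D_def)
    then show "phi \<in> dual_pre (n i) (n (i - 1)) (d i) ` mcarrier (hom_mod (fmod (n (i - 1))) ring_mod)"
      using chi_mem by blast
  next
    fix phi assume "phi \<in> dual_pre (n i) (n (i - 1)) (d i) ` mcarrier (hom_mod (fmod (n (i - 1))) ring_mod)"
    then obtain psi where psi: "mlinear psi (fmod (n j)) ring_mod"
      and phi: "phi = (\<lambda>v. if v \<in> mcarrier (fmod (n i)) then psi (D j v) else 0)"
      by (auto simp: hom_mod_def j dual_pre_def D_def fun_eq_iff)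
    have "mlinear phi (fmod (n (Suc j))) ring_mod"
      unfolding phi j using amodule_fmod mlinear_comp[OF D psi] by (rule mlinear_restrict)
    moreover have "phi (D (Suc j) v) = 0" if "v \<in> mcarrier (fmod (n (Suc (Suc j))))" for v
      using D_D[OF that] mlinear_zero[OF amodule_fmod amodule_ring_mod psi] by (simp add: phi j ring_mod_def)
    ultimately show "phi \<in> ?C"
      by (auto simp: hom_mod_def j dual_pre_def D_def ring_mod_def phi)
  qed
qed

text \<open>Composing the augmentation with the isomorphism turns a resolution of \<open>M\<close>
  into one of \<open>N\<close> with the same matrices, and the cohomology condition mentions only
  the matrices.\<close>

lemma ext_zero_miso:
  assumes N: "amodule N" and iso: "miso M N" and ext: "ext_zero i N"
  shows "ext_zero i M"
proof -
  obtain f where f: "mlinear f M N" and bij: "bij_betw f (mcarrier M) (mcarrier N)"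
    using iso by (auto simp: miso_def)
  have "free_res N n d (\<lambda>u. f (eps u))" if F: "free_res M n d eps" for n d eps
  proof -
    have eps: "mlinear eps (fmod (n 0)) M" "eps ` mcarrier (fmod (n 0)) = mcarrier M"
      "{v \<in> mcarrier (fmod (n 0)). eps v = mzero M} = matmap (n 0) (n 1) (d 1) ` mcarrier (fmod (n 1))"
      using F by (simp_all add: free_res_def)
    have fe: "mlinear (\<lambda>u. f (eps u)) (fmod (n 0)) N" using eps(1) f by (rule mlinear_comp)
    have z: "mzero (fmod (n 0)) \<in> mcarrier (fmod (n 0))" by (rule amodule.zero_closed[OF amodule_fmod])
    have "mzero (fmod (n 1)) \<in> mcarrier (fmod (n 1))" by (rule amodule.zero_closed[OF amodule_fmod])
    moreover have "matmap (n 0) (n 1) (d 1) (mzero (fmod (n 1))) = mzero (fmod (n 0))"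
      by (rule mlinear_zero[OF amodule_fmod amodule_fmod mlinear_matmap])
    ultimately have "mzero (fmod (n 0)) \<in> matmap (n 0) (n 1) (d 1) ` mcarrier (fmod (n 1))" by (metis imageI)
    \<comment> \<open>\<open>M\<close> is an arbitrary record here, later a dual; its zero is
      located as the image of zero under the augmentation, since zero lies in the image of the first
      differential.\<close>
    then have "eps (mzero (fmod (n 0))) = mzero M" using eps(3) by blast
    then have f0: "f (mzero M) = mzero N" "mzero M \<in> mcarrier M"
      using mlinear_zero[OF amodule_fmod N fe] mlinear_closed[OF eps(1) z] by auto
    have "f (eps v) = mzero N \<longleftrightarrow> eps v = mzero M" if "v \<in> mcarrier (fmod (n 0))" for v
      using f0 bij mlinear_closed[OF eps(1) that] unfolding bij_betw_def inj_on_def by metis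
    then have "{v \<in> mcarrier (fmod (n 0)). f (eps v) = mzero N} = {v \<in> mcarrier (fmod (n 0)). eps v = mzero M}"
      by blast
    moreover have "(\<lambda>u. f (eps u)) ` mcarrier (fmod (n 0)) = mcarrier N"
      using eps(2) bij unfolding bij_betw_def by (metis image_image)
    ultimately show ?thesis using F fe unfolding free_res_def by simp
  qed
  then show ?thesis using ext unfolding ext_zero_def by blast
qed

subsection \<open>Total reflexivity\<close>

lemma hom_mod_add_closed:
  assumes "amodule M" "amodule N" "f \<in> mcarrier (hom_mod M N)" "g \<in> mcarrier (hom_mod M N)"
  shows "madd (hom_mod M N) f g \<in> mcarrier (hom_mod M N)"
  using mlinear_restrict[OF assms(1) mlinear_plus[OF assms(2)], of f g "mzero N"] assms(3,4)
  by (simp add: hom_mod_def)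

lemma hom_mod_smul_closed:
  assumes "amodule M" "amodule N" "f \<in> mcarrier (hom_mod M N)"
  shows "msmul (hom_mod M N) r f \<in> mcarrier (hom_mod M N)"
  using mlinear_restrict[OF assms(1) mlinear_scale[OF assms(2)], of f r "mzero N"] assms(3)
  by (simp add: hom_mod_def)

lemma mlinear_bidual_map:
  assumes M: "amodule M"
  shows "mlinear (bidual_map M) M (dual_mod (dual_mod M))"
proof -
  interpret amodule M by (rule M)
  note add = hom_mod_add_closed[OF M amodule_ring_mod] and smul = hom_mod_smul_closed[OF M amodule_ring_mod]
  show ?thesis
  proof (rule mlinearI)
    fix u v r assume u: "u \<in> mcarrier M"
    have "mlinear (bidual_map M u) (dual_mod M) ring_mod"
    proof (rule mlinearI)
      fix f g r assume f: "f \<in> mcarrier (dual_mod M)"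
      show "bidual_map M u f \<in> mcarrier ring_mod" by (simp add: ring_mod_def)
      show "bidual_map M u (msmul (dual_mod M) r f) = msmul ring_mod r (bidual_map M u f)"
        using f u smul[of f r] by (simp add: bidual_map_def dual_mod_def) (simp add: hom_mod_def)
      assume g: "g \<in> mcarrier (dual_mod M)"
      show "bidual_map M u (madd (dual_mod M) f g) = madd ring_mod (bidual_map M u f) (bidual_map M u g)"
        using f g u add[of f g] by (simp add: bidual_map_def dual_mod_def) (simp add: hom_mod_def)
    qed
    then show "bidual_map M u \<in> mcarrier (dual_mod (dual_mod M))"
      by (simp add: dual_mod_def[of "dual_mod M"] hom_mod_def[of "dual_mod M"] bidual_map_def ring_mod_def)
    have "phi (msmul M r u) = r * phi u" if "phi \<in> mcarrier (dual_mod M)" for phi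
      using that u by (simp add: dual_mod_def hom_mod_def mlinear_def ring_mod_def)
    then show "bidual_map M (msmul M r u) = msmul (dual_mod (dual_mod M)) r (bidual_map M u)"
      by (auto simp: bidual_map_def dual_mod_def[of "dual_mod M"] hom_mod_def[of "dual_mod M"] ring_mod_def fun_eq_iff)
    assume v: "v \<in> mcarrier M"
    have "phi (madd M u v) = phi u + phi v" if "phi \<in> mcarrier (dual_mod M)" for phi
      using that u v by (simp add: dual_mod_def hom_mod_def mlinear_def ring_mod_def)
    then show "bidual_map M (madd M u v) = madd (dual_mod (dual_mod M)) (bidual_map M u) (bidual_map M v)"
      by (auto simp: bidual_map_def dual_mod_def[of "dual_mod M"] hom_mod_def[of "dual_mod M"] ring_mod_def fun_eq_iff)
  qed
qed

lemma fin_gen_tri: "fin_gen (tri p c q)"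
proof -
  let ?M = "tri p c q" and ?S = "{cl p c q 1 0, cl p c q 0 1}"
  interpret amodule ?M by (rule amodule_tri)
  have "submodule (mcarrier ?M) ?M"
    unfolding submodule_def using zero_closed add_closed smul_closed by blast
  moreover have S: "?S \<subseteq> mcarrier ?M" by simp
  ultimately have "mspan ?M ?S \<subseteq> mcarrier ?M" unfolding mspan_def by (intro Inter_lower) simp
  moreover have "X \<in> T" if X: "X \<in> mcarrier ?M" and T: "submodule T ?M" "?S \<subseteq> T" for X T
  proof -
    obtain u v where uv: "X = cl p c q u v" using X by (auto simp: tri_carrier)
    have "\<And>X Y. X \<in> T \<Longrightarrow> Y \<in> T \<Longrightarrow> madd ?M X Y \<in> T" "\<And>X s. X \<in> T \<Longrightarrow> msmul ?M s X \<in> T"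
      using T(1) unfolding submodule_def by blast+
    then have "madd ?M (msmul ?M u (cl p c q 1 0)) (msmul ?M v (cl p c q 0 1)) \<in> T"
      using T(2) by (metis insert_subset)
    then show ?thesis by (simp add: uv)
  qed
  then have "mcarrier ?M \<subseteq> mspan ?M ?S" unfolding mspan_def by (intro subsetI InterI) simp
  ultimately have "mspan ?M ?S = mcarrier ?M" by (rule equalityI)
  then show ?thesis unfolding fin_gen_def using S by (intro exI[of _ ?S]) simp
qed

section \<open>The two-periodic resolution and biduality\<close>

context regular_pair
begin

text \<open>Exactness at one spot of the resolution, with the kernel of \<open>tmat x a y\<close> on
  the left and the image of \<open>tmat y (- a) x\<close> on the right. The annihilator of
  \<open>y\<close> yields \<open>w\<close>, then that of \<open>x\<close> yields
  \<open>u\<close>.\<close>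

lemma tmat_exact:
  "x * u + a * w = 0 \<and> y * w = 0 \<longleftrightarrow> (\<exists>s t. u = y * s + - a * t \<and> w = x * t)"
proof
  assume 1: "x * u + a * w = 0 \<and> y * w = 0"
  then obtain t where t: "w = x * t" using ann_y by blast
  have "x * (u + a * t) = 0" using 1 t by (simp add: algebra_simps)
  then obtain s where "u + a * t = y * s" using ann_x by blast
  then show "\<exists>s t. u = y * s + - a * t \<and> w = x * t"
    using t by (intro exI2[of _ s t]) (simp add: algebra_simps)
next
  assume "\<exists>s t. u = y * s + - a * t \<and> w = x * t"
  then obtain s t where u: "u = y * s + - a * t" and w: "w = x * t" by blast
  show "x * u + a * w = 0 \<and> y * w = 0" unfolding u w by (simp add: xy xy_left algebra_simps)
qed

text \<open>The transposed statement: a row vector \<open>(P, Q)\<close> killed by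
  \<open>tmat y (- a) x\<close> is a row vector \<open>(\<alpha>, \<beta>)\<close> times
  \<open>tmat x a y\<close>.\<close>

lemma tmat_dual_exact:
  assumes "y * P = 0" "- a * P + x * Q = 0"
  shows "\<exists>\<alpha> \<beta>. P = x * \<alpha> \<and> Q = a * \<alpha> + y * \<beta>"
proof -
  obtain \<alpha> where \<alpha>: "P = x * \<alpha>" using ann_y assms(1) by blast
  have "x * (Q - a * \<alpha>) = 0" using assms(2) \<alpha> by (simp add: algebra_simps)
  then obtain \<beta> where "Q - a * \<alpha> = y * \<beta>" using ann_x by blast
  then show ?thesis using \<alpha> by (intro exI2[of _ \<alpha> \<beta>]) (simp add: algebra_simps)
qed

lemma matmap_tmat_exact:
  "{v \<in> mcarrier (fmod 2). matmap 2 2 (tmat x a y) v = mzero (fmod 2)}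
    = matmap 2 2 (tmat y (- a) x) ` mcarrier (fmod 2)"
proof (rule set_eqI)
  fix v :: "nat \<Rightarrow> 'a"
  have "(\<exists>u w. v = vec2 u w \<and> x * u + a * w = 0 \<and> y * w = 0)
    \<longleftrightarrow> (\<exists>s t. v = vec2 (y * s + - a * t) (x * t))"
    unfolding tmat_exact by blast
  then show "v \<in> {v \<in> mcarrier (fmod 2). matmap 2 2 (tmat x a y) v = mzero (fmod 2)}
      \<longleftrightarrow> v \<in> matmap 2 2 (tmat y (- a) x) ` mcarrier (fmod 2)"
    by (auto simp: image_tmat fmod2_iff)
qed

lemma tmat_cocycle:
  assumes phi: "mlinear phi (fmod 2) ring_mod"
    and cocycle: "\<And>v. v \<in> mcarrier (fmod 2) \<Longrightarrow> phi (matmap 2 2 (tmat y (- a) x) v) = 0"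
  shows "\<exists>psi. mlinear psi (fmod 2) ring_mod \<and>
    (\<forall>v\<in>mcarrier (fmod 2). phi v = psi (matmap 2 2 (tmat x a y) v))"
proof -
  define P Q where "P = phi (vec2 1 0)" and "Q = phi (vec2 0 1)"
  have vec: "vec2 u w \<in> mcarrier (fmod 2)" for u w :: 'a by (auto simp: fmod2_iff)
  have val: "phi (vec2 u w) = u * P + w * Q" for u w
  proof -
    have "phi (madd (fmod 2) (msmul (fmod 2) u (vec2 1 0)) (msmul (fmod 2) w (vec2 0 1))) = u * P + w * Q"
      using mlinear_add[OF phi] mlinear_smul[OF phi] vec amodule.smul_closed[OF amodule_fmod vec]
      by (simp only: P_def Q_def) (simp add: ring_mod_def)
    then show ?thesis by simp
  qed
  have "y * P = 0" "- a * P + x * Q = 0"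
    using cocycle[of "vec2 1 0"] cocycle[of "vec2 0 1"] vec by (simp_all add: val)
  then obtain \<alpha> \<beta> where PQ: "P = x * \<alpha>" "Q = a * \<alpha> + y * \<beta>" using tmat_dual_exact by blast
  define psi where "psi v = v 0 * \<alpha> + v 1 * \<beta>" for v :: "nat \<Rightarrow> 'a"
  have "mlinear psi (fmod 2) ring_mod"
    by (rule mlinearI) (simp_all add: psi_def fmod_def ring_mod_def algebra_simps)
  moreover have "phi v = psi (matmap 2 2 (tmat x a y) v)" if "v \<in> mcarrier (fmod 2)" for v
    using that by (auto simp: fmod2_iff val psi_def PQ algebra_simps)
  ultimately show ?thesis by blast
qed

lemma ext_zero_tri:
  assumes "i > 0"
  shows "ext_zero i (tri x a y)"
proof -
  interpret sw: regular_pair y x by (rule swap)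
  \<comment> \<open>\<open>e 1\<close> presents the module, hence the parity. The even steps are the
    odd ones for the exchanged pair and \<open>- a\<close>, because
    \<open>- (- a) = a\<close>.\<close>
  define e where "e i = (if odd i then tmat x a y else tmat y (- a) x)" for i :: nat
  let ?eta = "mcoset (fmod 2) (matmap 2 2 (tmat x a y) ` mcarrier (fmod 2))"
  have eta: "?eta (vec2 u v) = cl x a y u v" for u v by (simp add: cl_def)
  have "free_res (tri x a y) (\<lambda>i. 2) e ?eta"
    unfolding free_res_def
  proof (intro conjI allI impI)
    show "mlinear ?eta (fmod 2) (tri x a y)"
      by (rule mlinearI) (auto simp: fmod2_iff eta)
    show "?eta ` mcarrier (fmod 2) = mcarrier (tri x a y)"
      by (simp add: coker_def qmod_def)
    show "{v \<in> mcarrier (fmod 2). ?eta v = mzero (tri x a y)} = matmap 2 2 (e 1) ` mcarrier (fmod 2)"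
    proof (rule set_eqI)
      fix v :: "nat \<Rightarrow> 'a"
      have "(\<exists>u w. v = vec2 u w \<and> cl x a y u w = cl x a y 0 0) \<longleftrightarrow> (\<exists>s t. v = vec2 (x * s + a * t) (y * t))"
        unfolding cl_eq_zero_iff by blast
      then show "v \<in> {v \<in> mcarrier (fmod 2). ?eta v = mzero (tri x a y)} \<longleftrightarrow> v \<in> matmap 2 2 (e 1) ` mcarrier (fmod 2)"
        unfolding e_def by (simp add: image_tmat) (metis eta fmod2_iff)
    qed
    show "{v \<in> mcarrier (fmod 2). matmap 2 2 (e i) v = mzero (fmod 2)} = matmap 2 2 (e (Suc i)) ` mcarrier (fmod 2)" for i
      using matmap_tmat_exact[of a] sw.matmap_tmat_exact[of "- a"] by (simp add: e_def)
  qed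
  then show ?thesis
  proof (rule ext_zero_resolution[OF amodule_tri _ assms])
    fix i phi assume "mlinear phi (fmod 2) ring_mod"
      and "\<And>v. v \<in> mcarrier (fmod 2) \<Longrightarrow> phi (matmap 2 2 (e (Suc i)) v) = 0"
    then show "\<exists>psi. mlinear psi (fmod 2) ring_mod \<and> (\<forall>v\<in>mcarrier (fmod 2). phi v = psi (matmap 2 2 (e i) v))"
      using tmat_cocycle[of phi a] sw.tmat_cocycle[of phi "- a"] by (cases "odd i") (simp_all add: e_def)
  qed
qed

lemma tri_rel_ring: "tri_rel x a y ring_mod F G \<longleftrightarrow> x * F = 0 \<and> a * F + y * G = 0"
  by (simp add: tri_rel_def ring_mod_def)

lemma dual_rel:
  assumes "tri_rel x a y ring_mod F G"
  shows "\<exists>u v. F = y * v \<and> G = x * u - a * v"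
proof -
  have F: "x * F = 0" "a * F + y * G = 0" using assms by (simp_all add: tri_rel_ring)
  then obtain v where v: "F = y * v" using ann_x by blast
  have "y * (a * v + G) = 0" using F v by (simp add: algebra_simps)
  then obtain u where "a * v + G = x * u" using ann_y by blast
  then show ?thesis using v by (intro exI2[of _ u v]) (simp add: algebra_simps)
qed

lemma rel_dual: "tri_rel x a y ring_mod (y * v) (x * u - a * v)"
  by (simp add: tri_rel_ring xy xy_left algebra_simps)

text \<open>A functional is given by the values \<open>y * v\<close> and
  \<open>x * u - a * v\<close> on the generators, and \<open>tmat_exact\<close> for
  \<open>- a\<close> computes which parameters give zero. So the dual of \<open>G_a\<close> is
  \<open>H\<close> with corner parameter \<open>- a\<close>.\<close>

lemma miso_dual: "miso (dual_mod (tri x a y)) (tri y a x)"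
  unfolding dual_mod_def
proof (rule miso_hom_tri[OF amodule_ring_mod rel_dual])
  show "y * v = mzero ring_mod \<and> x * u - a * v = mzero ring_mod \<longleftrightarrow> (\<exists>s t. u = y * s + a * t \<and> v = x * t)" for u v
    using tmat_exact[of u "- a" v] by (simp add: ring_mod_def conj_commute)
  show "\<exists>u v. F = y * v \<and> G = x * u - a * v" if "tri_rel x a y ring_mod F G" for F G
    using that by (rule dual_rel)
qed (simp_all add: ring_mod_def algebra_simps)

lemma bij_bidual_map:
  "bij_betw (bidual_map (tri x a y)) (mcarrier (tri x a y)) (mcarrier (dual_mod (dual_mod (tri x a y))))"
proof -
  let ?M = "tri x a y" and ?N = "dual_mod (dual_mod (tri x a y))"
  \<comment> \<open>The functionals in the coordinates of \<open>dual_rel\<close>; by that lemma and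
    \<open>dual_eqI\<close> there are no others.\<close>
  define \<phi> where "\<phi> z w = gen_hom x a y ring_mod (y * z) (x * w - a * z)" for z w
  have mem: "\<phi> z w \<in> mcarrier (dual_mod ?M)" for z w
    unfolding \<phi>_def dual_mod_def by (rule amodule.gen_hom_closed[OF amodule_ring_mod rel_dual])
  have val: "\<phi> z w (cl x a y u v) = u * (y * z) + v * (x * w - a * z)" for z w u v
    unfolding \<phi>_def amodule.gen_hom_cl[OF amodule_ring_mod rel_dual] by (simp add: ring_mod_def)
  have dual_eqI: "f = g" if "f \<in> mcarrier (dual_mod ?M)" "g \<in> mcarrier (dual_mod ?M)"
    "f (cl x a y 1 0) = g (cl x a y 1 0)" "f (cl x a y 0 1) = g (cl x a y 0 1)" for f g
  proof
    fix X
    have lin: "mlinear f ?M ring_mod" "mlinear g ?M ring_mod"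
      using that by (simp_all add: dual_mod_def hom_mod_def)
    show "f X = g X"
    proof (cases "X \<in> mcarrier ?M")
      case True
      then obtain u v where X: "X = cl x a y u v" by (auto simp: tri_carrier)
      show ?thesis
        unfolding X amodule.mlinear_tri(2)[OF amodule_ring_mod lin(1), of u v]
          amodule.mlinear_tri(2)[OF amodule_ring_mod lin(2), of u v] using that(3,4) by simp
    next
      case False
      then show ?thesis using that(1,2) by (simp add: dual_mod_def hom_mod_def)
    qed
  qed
  have lin: "mlinear (bidual_map ?M) ?M ?N" by (rule mlinear_bidual_map[OF amodule_tri])
  have "X = Y" if X: "X \<in> mcarrier ?M" and Y: "Y \<in> mcarrier ?M" and eq: "bidual_map ?M X = bidual_map ?M Y" for X Y
  proof -
    obtain u v u' v' where uv: "X = cl x a y u v" "Y = cl x a y u' v'" using X Y by (auto simp: tri_carrier)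
    have "u * (y * z) + v * (x * w - a * z) = u' * (y * z) + v' * (x * w - a * z)" for z w
      using fun_cong[OF eq, of "\<phi> z w"] mem[of z w] by (simp add: bidual_map_def uv val)
    \<comment> \<open>The functionals \<open>\<phi> 0 1\<close> and \<open>\<phi> 1 0\<close>
      already separate points.\<close>
    from this[of 0 1] this[of 1 0] have 1: "v * x = v' * x" "u * y - v * a = u' * y - v' * a" by simp_all
    have "x * (v - v') = 0" using 1(1) by (simp add: algebra_simps)
    then obtain t where t: "v - v' = y * t" using ann_x by blast
    have "y * (u - u' - a * t) = (u * y - v * a) - (u' * y - v' * a) + a * (v - v' - y * t)"
      by (simp add: algebra_simps)
    then have "y * (u - u' - a * t) = 0" using 1(2) t by simp
    then obtain s where "u - u' - a * t = x * s" using ann_y by blast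
    then show ?thesis unfolding uv cl_eq_iff using t by (intro exI2[of _ s t]) (simp add: algebra_simps)
  qed
  then have "inj_on (bidual_map ?M) (mcarrier ?M)" by (rule inj_onI)
  moreover have "\<Psi> \<in> bidual_map ?M ` mcarrier ?M" if \<Psi>: "\<Psi> \<in> mcarrier ?N" for \<Psi>
  proof -
    have \<Psi>_lin: "mlinear \<Psi> (dual_mod ?M) ring_mod" and ext: "\<And>f. f \<notin> mcarrier (dual_mod ?M) \<Longrightarrow> \<Psi> f = 0"
      using \<Psi> by (simp_all add: dual_mod_def[of "dual_mod ?M"] hom_mod_def[of "dual_mod ?M"] ring_mod_def)
    define P Q where "P = \<Psi> (\<phi> 1 0)" and "Q = \<Psi> (\<phi> 0 1)"
    have \<Psi>_val: "\<Psi> (\<phi> z w) = z * P + w * Q" for z w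
    proof -
      let ?s = "msmul (dual_mod ?M)"
      have s: "?s r (\<phi> z w) \<in> mcarrier (dual_mod ?M)" for r z w
        using mem unfolding dual_mod_def by (intro hom_mod_smul_closed amodule_tri amodule_ring_mod)
      have "\<phi> z w = madd (dual_mod ?M) (?s z (\<phi> 1 0)) (?s w (\<phi> 0 1))"
      proof (rule dual_eqI[OF mem])
        show "madd (dual_mod ?M) (?s z (\<phi> 1 0)) (?s w (\<phi> 0 1)) \<in> mcarrier (dual_mod ?M)"
          using s unfolding dual_mod_def by (intro hom_mod_add_closed amodule_tri amodule_ring_mod)
      qed (simp_all add: dual_mod_def hom_mod_def val ring_mod_def algebra_simps)
      then have "\<Psi> (\<phi> z w) = madd ring_mod (\<Psi> (?s z (\<phi> 1 0))) (\<Psi> (?s w (\<phi> 0 1)))"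
        using mlinear_add[OF \<Psi>_lin s s] by simp
      then show ?thesis
        using mlinear_smul[OF \<Psi>_lin mem] by (simp add: P_def Q_def ring_mod_def)
    qed
    have \<phi>_zero: "\<phi> z w = \<phi> 0 0" if "y * z = 0" "x * w - a * z = 0" for z w
      using that unfolding \<phi>_def by simp
    \<comment> \<open>The two relations between the generating functionals. Under
      \<open>\<Psi>\<close> they put \<open>(P, Q)\<close> into the kernel of
      \<open>tmat x a y\<close>, and exactness supplies the element whose evaluation is
      \<open>\<Psi>\<close>.\<close>
    have "\<phi> 0 y = \<phi> 0 0" "\<phi> x a = \<phi> 0 0" by (intro \<phi>_zero; simp add: xy algebra_simps)+
    then have PQ: "y * Q = 0" "x * P + a * Q = 0" using \<Psi>_val[of 0 y] \<Psi>_val[of x a] \<Psi>_val[of 0 0] by simp_all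
    from PQ obtain u v where uv: "P = y * u + - a * v" "Q = x * v" using tmat_exact[of P a Q] by blast
    have "\<Psi> f = bidual_map ?M (cl x a y u v) f" for f
    proof (cases "f \<in> mcarrier (dual_mod ?M)")
      case True
      then have "mlinear f ?M ring_mod" by (simp add: dual_mod_def hom_mod_def)
      then obtain w z where "f (cl x a y 1 0) = y * z" "f (cl x a y 0 1) = x * w - a * z"
        using dual_rel amodule.mlinear_tri(1)[OF amodule_ring_mod] by blast
      then have "f = \<phi> z w" by (intro dual_eqI True mem) (simp_all add: val)
      then show ?thesis using mem by (simp add: bidual_map_def val \<Psi>_val uv algebra_simps)
    next
      case False
      then show ?thesis by (simp add: bidual_map_def ext)
    qed
    then have "\<Psi> = bidual_map ?M (cl x a y u v)" by blast
    then show ?thesis by simp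
  qed
  ultimately show ?thesis using mlinear_closed[OF lin] unfolding bij_betw_def by blast
qed

lemma totally_reflexive_tri: "totally_reflexive (tri x a y)"
proof -
  have "ext_zero i (dual_mod (tri x a y))" if "i > 0" for i
    using amodule_tri miso_dual regular_pair.ext_zero_tri[OF swap that] by (rule ext_zero_miso)
  then show ?thesis
    by (simp add: totally_reflexive_def fin_gen_tri ext_zero_tri mlinear_bidual_map[OF amodule_tri] bij_bidual_map)
qed

end

section \<open>Specialisation to the products of the regular elements\<close>

theorem theorem6p1:
  fixes x y :: "'a::comm_ring_1" and b a :: "nat \<Rightarrow> 'a"
  assumes "noetherian_ring TYPE('a)" and "local_ring TYPE('a)"
    and "regular_exact_pair x y"
    and "\<forall>n\<ge>1. mregular (b n) (qmod ring_mod {x * r + y * s | r s. True})"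
    and "\<forall>n\<ge>1. a n = (\<Prod>i\<in>{1..n}. b i)"
  shows "(\<forall>n\<ge>1. indecomposable (Gmod x y (a n)) \<and> \<not> mfree (Gmod x y (a n))
                 \<and> totally_reflexive (Gmod x y (a n)))
       \<and> (\<forall>n\<ge>1. indecomposable (Hmod x y (a n)) \<and> \<not> mfree (Hmod x y (a n))
                 \<and> totally_reflexive (Hmod x y (a n)))
       \<and> (\<forall>m\<ge>1. \<forall>n\<ge>1. m \<noteq> n \<longrightarrow> \<not> miso (Gmod x y (a m)) (Gmod x y (a n))
                                 \<and> \<not> miso (Hmod x y (a m)) (Hmod x y (a n)))
       \<and> (\<forall>m\<ge>1. \<forall>n\<ge>1. \<not> miso (Gmod x y (a m)) (Hmod x y (a n)))
       \<and> (\<forall>m\<ge>1. \<forall>n\<ge>1.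
            miso (hom_mod (Hmod x y (a m)) (Gmod x y (a n))) (Gmod x y (a m * a n))
          \<and> miso (hom_mod (Hmod x y (a n)) (Gmod x y (a m))) (Gmod x y (a m * a n))
          \<and> miso (hom_mod (Gmod x y (a n)) (Hmod x y (a m))) (Hmod x y (a m * a n))
          \<and> miso (hom_mod (Gmod x y (a m)) (Hmod x y (a n))) (Hmod x y (a m * a n))
          \<and> (m \<ge> n \<longrightarrow>
               miso (hom_mod (Gmod x y (a m)) (Gmod x y (a n))) (Hmod x y (\<Prod>i\<in>{n<..m}. b i))
             \<and> miso (hom_mod (Hmod x y (a n)) (Hmod x y (a m))) (Hmod x y (\<Prod>i\<in>{n<..m}. b i)))
          \<and> (m \<le> n \<longrightarrow>
               miso (hom_mod (Gmod x y (a m)) (Gmod x y (a n))) (Gmod x y (\<Prod>i\<in>{m<..n}. b i))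
             \<and> miso (hom_mod (Hmod x y (a n)) (Hmod x y (a m))) (Gmod x y (\<Prod>i\<in>{m<..n}. b i))))"
proof -
  have "\<exists>m::'a set. ring_ideal m \<and> (\<forall>r. r \<in> m \<longleftrightarrow> \<not> r dvd 1)"
    using local_ring_nonunits[OF assms(2)] by metis
  then obtain m :: "'a set" where m: "ring_ideal m" "\<And>r. r \<in> m \<longleftrightarrow> \<not> r dvd 1"
    by blast
  interpret local_regular_pair x y m
    using assms(3) m by unfold_locales
  interpret sw: local_regular_pair y x m by (rule local_swap)
  have b_reg: "regular_mod x y (b i)" if "i \<ge> 1" for i
    using assms(4) that mregular_imp_regular_mod by blast
  have b_m: "b i \<in> m" if "i \<ge> 1" for i
    using assms(4) that by (simp add: mem_m mregular_def)
  \<comment> \<open>The quotient of \<open>a k\<close> by \<open>a n\<close>, expressed as a product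
    since the ring has no division.\<close>
  define e where "e n k = (\<Prod>i\<in>{n<..k}. b i)" for n k
  have a_e: "a k = a n * e n k" if "1 \<le> n" "n \<le> k" for n k
  proof -
    have "{1..k} = {1..n} \<union> {n<..k}" using that by auto
    moreover have "(\<Prod>i\<in>{1..n} \<union> {n<..k}. b i) = (\<Prod>i\<in>{1..n}. b i) * e n k"
      unfolding e_def by (rule prod.union_disjoint) auto
    ultimately show ?thesis using assms(5) that by simp
  qed
  have prod_m: "(\<Prod>i\<in>{n<..k}. b i) \<in> m" if "n < k" for n k
  proof -
    have "{n<..k} = insert k {n<..<k}" using that by auto
    then have "(\<Prod>i\<in>{n<..k}. b i) = b k * (\<Prod>i\<in>{n<..<k}. b i)" by simp
    then show ?thesis using b_m[of k] m_mult(2) that by simp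
  qed
  have e_m: "e n k \<in> m" if "n < k" for n k using prod_m[OF that] by (simp add: e_def)
  have a_m: "a n \<in> m" if "n \<ge> 1" for n
    using prod_m[of 0 n] assms(5) that by (simp add: atLeastSucAtMost_greaterThanAtMost[symmetric])
  have a_reg: "regular_mod x y (a n)" if "n \<ge> 1" for n
    using assms(5) that b_reg by (auto intro: regular_mod_prod)
  \<comment> \<open>The second form is what \<open>H\<close> requires: it belongs to the exchanged
    pair with corner \<open>- a n\<close>.\<close>
  have reg: "regular_mod x y (a n)" "regular_mod y x (- a n)" if "n \<ge> 1" for n
    using a_reg[OF that] regular_mod_minus[OF regular_mod_swap] by simp_all
  have am: "a n \<in> m" "- a n \<in> m" if "n \<ge> 1" for n
    using a_m[OF that] m_minus by auto
  have G: "Gmod x y c = tri x c y" and H: "Hmod x y c = tri y (- c) x" for c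
    by (simp_all add: Gmod_def Hmod_def)
  have gt: "\<not> miso (tri x (a k) y) (tri x (a n) y)" "\<not> miso (tri y (- a k) x) (tri y (- a n) x)"
    if "1 \<le> n" "n < k" for n k
  proof -
    have ak: "a k = a n * e n k" "- a k = - a n * e n k" using a_e[of n k] that by simp_all
    show "\<not> miso (tri x (a k) y) (tri x (a n) y)"
      unfolding ak(1) using reg(1)[OF that(1)] am(1)[OF that(1)] e_m[OF that(2)] by (rule not_miso_down)
    show "\<not> miso (tri y (- a k) x) (tri y (- a n) x)"
      unfolding ak(2) using reg(2)[OF that(1)] am(2)[OF that(1)] e_m[OF that(2)] by (rule sw.not_miso_down)
  qed
  have distinct: "\<not> miso (tri x (a k) y) (tri x (a n) y)" "\<not> miso (tri y (- a k) x) (tri y (- a n) x)"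
    if "1 \<le> k" "1 \<le> n" "k \<noteq> n" for k n
    using gt[of n k] gt[of k n] that miso_sym[OF amodule_tri] by (metis nat_neq_iff)+
  have GH: "\<not> miso (tri x (a k) y) (tri y (- a n) x)" if "1 \<le> k" "1 \<le> n" for k n
    using reg(2)[OF that(2)] am(2)[OF that(2)] am(1)[OF that(1)] by (rule sw.not_miso_opposite)
  \<comment> \<open>The corner produced is minus the product of \<open>- a k\<close> and
    \<open>a n\<close>, so the signs cancel. Both orders of the product are recorded because the
    goal exchanges the indices.\<close>
  have HG_hom: "miso (hom_mod (tri y (- a k) x) (tri x (a n) y)) (tri x (a k * a n) y)"
      "miso (hom_mod (tri y (- a k) x) (tri x (a n) y)) (tri x (a n * a k) y)" if "1 \<le> n" for k n
    using miso_hom_opposite(2)[OF reg(1)[OF that], of "- a k"] by (simp_all add: mult.commute)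
  have GH_hom: "miso (hom_mod (tri x (a k) y) (tri y (- a n) x)) (tri y (- (a k * a n)) x)"
      "miso (hom_mod (tri x (a k) y) (tri y (- a n) x)) (tri y (- (a n * a k)) x)" if "1 \<le> n" for k n
    using sw.miso_hom_opposite(1)[OF reg(2)[OF that], of "a k"] by (simp_all add: mult.commute)
  \<comment> \<open>Among the \<open>H\<close> modules the arrow is reversed, so the same answer
    comes from \<open>miso_hom_up\<close> for the exchanged pair; in \<open>up\<close> the two
    lemmas trade places.\<close>
  have down: "miso (hom_mod (tri x (a k) y) (tri x (a n) y)) (tri y (- e n k) x)"
      "miso (hom_mod (tri y (- a n) x) (tri y (- a k) x)) (tri y (- e n k) x)"
    if "1 \<le> n" "n \<le> k" for k n
    using miso_hom_down(2)[OF reg(1)[OF that(1)], of "e n k"]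
      sw.miso_hom_up(2)[OF reg(2)[OF that(1)], of "e n k"] a_e[OF that] by simp_all
  have up: "miso (hom_mod (tri x (a k) y) (tri x (a n) y)) (tri x (e k n) y)"
      "miso (hom_mod (tri y (- a n) x) (tri y (- a k) x)) (tri x (e k n) y)"
    if "1 \<le> k" "k \<le> n" for k n
    using miso_hom_up(1)[OF reg(1)[OF that(1)], of "e k n"]
      sw.miso_hom_down(1)[OF reg(2)[OF that(1)], of "e k n"] a_e[OF that] by simp_all
  show ?thesis
    unfolding G H e_def[symmetric]
    by (intro conjI allI impI indecomposable_tri sw.indecomposable_tri not_mfree_tri sw.not_mfree_tri
        totally_reflexive_tri sw.totally_reflexive_tri distinct GH HG_hom GH_hom down up reg am)
qed

end
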